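(* Let $x,y$ be positive integers with $x<y$ and $\gcd(x,y)=1$. Then the period $p(x,y)$ of a periodic orbit on the $60^\circ$-rhombus with initial angle $\Theta=\arctan\left(\frac{y}{x}\sqrt{3}\right)$ is $$p(x,y)=\begin{cases} 2y+\frac{2x}{3} & \text{if } x\equiv 0 \bmod 3 \text{ and } x\equiv y \bmod 2,\\ 4y+\frac{4x}{3} & \text{if } x\equiv 0 \bmod 3 \text{ and } x\not\equiv y \bmod 2,\\ 2y+\frac{2x-2}{3} \text{ or } 4y+\frac{4x+2}{3} & \text{if } x\equiv 1 \bmod 3 \text{ and } x\equiv y \bmod 2,\\ 4y+\frac{4x+2}{3} \text{ or } 8y+\frac{8x-2}{3} & \text{if } x\equiv 1 \bmod 3 \text{ and } x\not\equiv y \bmod 2,\\ 2y+\frac{2x+2}{3} \text{ or } 4y+\frac{4x-2}{3} & \text{if } x\equiv 2 \bmod 3 \text{ and } x\equiv y \bmod 2,\\ 4y+\frac{4x-2}{3} \text{ or } 8y+\frac{8x+2}{3} & \text{if } x\equiv 2 \bmod 3 \text{ and } x\not\equiv y \bmod 2. \end{cases}$$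
   Context: Billiards: a point particle moves with unit speed along straight lines in a polygon $G$, reflecting elastically at the edges (angle of incidence equals angle of reflection). Its path is its orbit. An orbit that reaches a vertex terminates and is singular; otherwise it is non-singular. A non-singular orbit is periodic if it begins and ends at the same point and the particle retraces its orbit when allowed to continue. A periodic orbit is primitive if it is traversed exactly once. The period of a periodic orbit is the number of times the particle strikes $\partial G$ while traversing a primitive sub-orbit. Rhombus: the $60^\circ$-rhombus is a rhombus with interior angles $60^\circ,120^\circ,60^\circ,120^\circ$, positioned so that its long diagonal $\overline{AC}$ is horizontal with $A$ to the left of $C$ (it is the union of a $120^\circ$-isosceles triangle with base $\overline{AC}$ and its reflection in $\overline{AC}$). Orbits start at a point $P$ in the interior of the long diagonal $\overline{AC}$; the initial angle $\Theta$ is the angle between the ray from $P$ towards $C$ and the initial (upward) direction of motion. Crossing the diagonal does not count as a strike of the boundary. *)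

theory Defs
  imports "HOL-Analysis.Analysis"
begin

text \<open>A polygon is given by the cyclic list of its vertices, as points of the complex plane.\<close>

definition vertex :: "complex list \<Rightarrow> nat \<Rightarrow> complex" where
  "vertex vs i = vs ! (i mod length vs)"

definition boundary :: "complex list \<Rightarrow> complex set" where
  "boundary vs = (\<Union>i<length vs. closed_segment (vertex vs i) (vertex vs (Suc i)))"

text \<open>Mirror image of the velocity \<open>w\<close> in a line of direction \<open>d\<close>: the component along
  \<open>d\<close> is kept and the normal component changes sign, so the angle of incidence equals the
  angle of reflection.\<close>

definition reflect_velocity :: "complex \<Rightarrow> complex \<Rightarrow> complex" where
  "reflect_velocity d w = (2 * (w \<bullet> d) / (d \<bullet> d)) *\<^sub>R d - w"

text \<open>The position \<open>\<gamma> t\<close> at time \<open>t \<ge> 0\<close> of a particle that leaves \<open>P\<close> with velocity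
  \<open>u\<close>. Here \<open>\<tau> 1 < \<tau> 2 < \<dots>\<close> are the times at which it strikes the boundary, and \<open>w n\<close> is its
  velocity between the times \<open>\<tau> n\<close> and \<open>\<tau> (Suc n)\<close>. Every strike is in the relative interior
  of an edge, so no vertex is ever reached. The values of \<open>\<gamma>\<close> at negative times are irrelevant.
  The strikes do not accumulate, so \<open>\<gamma>\<close> is determined for all times \<open>t \<ge> 0\<close>.\<close>

definition nonsingular_orbit ::
    "complex list \<Rightarrow> complex \<Rightarrow> complex \<Rightarrow> (real \<Rightarrow> complex) \<Rightarrow> bool" where
  "nonsingular_orbit vs P u \<gamma> \<longleftrightarrow>
     \<gamma> 0 = P \<and>
     (\<exists>(\<tau> :: nat \<Rightarrow> real) (w :: nat \<Rightarrow> complex).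
        \<tau> 0 = 0 \<and> strict_mono \<tau> \<and> filterlim \<tau> at_top sequentially \<and> w 0 = u \<and>
        (\<forall>n. (\<forall>t\<in>{\<tau> n..\<tau> (Suc n)}. \<gamma> t = \<gamma> (\<tau> n) + (t - \<tau> n) *\<^sub>R w n) \<and>
             (\<forall>t\<in>{\<tau> n<..<\<tau> (Suc n)}. \<gamma> t \<notin> boundary vs) \<and>
             (\<exists>i<length vs.
                \<gamma> (\<tau> (Suc n)) \<in> open_segment (vertex vs i) (vertex vs (Suc i)) \<and>
                w (Suc n) = reflect_velocity (vertex vs (Suc i) - vertex vs i) (w n))))"

definition retraces_after :: "(real \<Rightarrow> complex) \<Rightarrow> real \<Rightarrow> bool" where
  "retraces_after \<gamma> T \<longleftrightarrow> 0 < T \<and> (\<forall>t\<ge>0. \<gamma> (t + T) = \<gamma> t)"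

definition periodic_orbit ::
    "complex list \<Rightarrow> complex \<Rightarrow> complex \<Rightarrow> (real \<Rightarrow> complex) \<Rightarrow> bool" where
  "periodic_orbit vs P u \<gamma> \<longleftrightarrow> nonsingular_orbit vs P u \<gamma> \<and> (\<exists>T. retraces_after \<gamma> T)"

text \<open>The primitive sub-orbit is the part of the orbit up to this time.\<close>

definition primitive_time :: "(real \<Rightarrow> complex) \<Rightarrow> real" where
  "primitive_time \<gamma> = (LEAST T. retraces_after \<gamma> T)"

definition orbit_period :: "complex list \<Rightarrow> (real \<Rightarrow> complex) \<Rightarrow> nat" where
  "orbit_period vs \<gamma> = card {t \<in> {0<..primitive_time \<gamma>}. \<gamma> t \<in> boundary vs}"

text \<open>The \<open>60\<close>-degree rhombus with side length \<open>l\<close>, left vertex \<open>A\<close> and horizontal long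
  diagonal from \<open>A\<close> to \<open>rhombus60_C A l\<close>: the sides at \<open>A\<close> make angles \<open>\<plusminus>\<pi>/6\<close> with it, and its
  length is \<open>2 l cos (\<pi>/6)\<close>.\<close>

definition rhombus60_C :: "complex \<Rightarrow> real \<Rightarrow> complex" where
  "rhombus60_C A l = A + of_real (sqrt 3 * l)"

definition rhombus60 :: "complex \<Rightarrow> real \<Rightarrow> complex list" where
  "rhombus60 A l =
     [A, A + of_real l * cis (- (pi / 6)), rhombus60_C A l, A + of_real l * cis (pi / 6)]"

end

theory Submission
  imports Defs
begin

text \<open>Use the sides of the rhombus at \<open>A\<close> as a basis of the plane. The rhombus
  becomes the unit square, and unit triangles of the equilateral lattice become half squares.
  Reflecting the plane instead of the particle turns an orbit into a straight line: at every time
  the position is \<open>h (line t)\<close>, where \<open>h\<close> lies in the affine Weyl group of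
  the triangular lattice and reverses orientation exactly if the number of strikes so far is odd
  (\<open>leg_unfolds\<close>).

  The images of the sides of the rhombus under this group are the lattice edges that have an end
  \<open>(i, j)\<close> with \<open>i \<equiv> j\<close> modulo 3. They form the set
  \<open>walls\<close>. It is invariant under the group, so the strikes are exactly the times at
  which the line meets \<open>walls\<close> (\<open>strike_times\<close>), whatever \<open>h\<close>
  is. The remaining lattice edges are images of the short diagonal.

  Let \<open>s\<close> be 2 if \<open>x\<close> and \<open>y\<close> have the same parity, and 1
  otherwise. The line has direction \<open>(p, p - 3 D)\<close>, where \<open>p = (x + 3 y) /
  s\<close> and \<open>D = 2 y / s\<close> are coprime. Hence the shortest time \<open>T\<close>
  after which it is translated by a vector of the group is the one in which it advances by
  \<open>(p, p - 3 D)\<close>. The orbit can retrace itself only after multiples of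
  \<open>T\<close>, since no other element of the linear group fixes the direction
  (\<open>retrace_time\<close>). It does so after \<open>k T\<close> precisely if \<open>k S\<close>
  is even, where \<open>S\<close> is the number of strikes in a time \<open>T\<close>: the identity
  is the only orientation-preserving element of the group that maps an interior point of the rhombus
  into the rhombus (\<open>retraces\<close>). So the period is \<open>S\<close> or \<open>2
  S\<close>, whichever is even first.

  It remains to find \<open>S\<close>. During \<open>T\<close> the line crosses \<open>p\<close>
  lines \<open>a = k\<close> with integer \<open>k\<close>. Between consecutive crossings there is
  one crossing of a line of the other two directions, and a look at the two triangles involved shows
  that each such step contains one strike, or two if the edge at its beginning is not a wall
  (\<open>card_walls_strip\<close>). The crossing points are equidistributed modulo 3, so that about
  a third of the steps, rounded up or down, are of the second kind (\<open>card_stripe\<close>).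
  Thus \<open>S\<close> is \<open>p\<close> plus \<open>p / 3\<close> rounded up or down, and the
  residue of \<open>p\<close> modulo 3 yields the cases of the theorem.\<close>

section \<open>The affine Weyl group and the walls\<close>

text \<open>In the basis of two unit vectors at an angle of \<open>\<pi> / 3\<close>, these are the matrices of
  the symmetries of an equilateral triangle, each with the information whether it is a rotation.\<close>

definition weyl_matrices :: "(bool \<times> int \<times> int \<times> int \<times> int) set" where
  "weyl_matrices =
     {(True, 1, 0, 0, 1), (True, 0, 1, -1, -1), (True, -1, -1, 1, 0),
      (False, 0, -1, -1, 0), (False, -1, 0, 1, 1), (False, 1, 1, 0, -1)}"

text \<open>The translations \<open>(i, j)\<close> with \<open>i \<equiv> j\<close> modulo 3 are those that
  preserve the 3-colouring of the vertices of the triangular lattice by \<open>i - j\<close> modulo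
  3. The flag records that the map preserves orientation.\<close>

definition weyl :: "bool \<Rightarrow> (real \<times> real \<Rightarrow> real \<times> real) \<Rightarrow> bool" where
  "weyl e h \<longleftrightarrow> (\<exists>m n m' n' i j :: int. (e, m, n, m', n') \<in> weyl_matrices \<and> 3 dvd (i - j) \<and>
     h = (\<lambda>(a, b). (real_of_int m * a + real_of_int n * b + real_of_int i,
       real_of_int m' * a + real_of_int n' * b + real_of_int j)))"

text \<open>The six shapes, with the additions carried out. The last three are glide reflections along, or
  reflections in, lines of the three lattice directions \<open>a + b = 0\<close>, \<open>a =
  0\<close> and \<open>b = 0\<close>.\<close>

lemma weyl_cases [consumes 1, case_names id rot rot' flip_c flip_a flip_b]:
  fixes h :: "real \<times> real \<Rightarrow> real \<times> real"
  assumes "weyl e h"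
  obtains i j :: int where "e" "3 dvd (i - j)" "h = (\<lambda>(a, b). (a + real_of_int i, b + real_of_int j))"
  | i j :: int where "e" "3 dvd (i - j)" "h = (\<lambda>(a, b). (b + real_of_int i, real_of_int j - a - b))"
  | i j :: int where "e" "3 dvd (i - j)" "h = (\<lambda>(a, b). (real_of_int i - a - b, a + real_of_int j))"
  | i j :: int where "\<not> e" "3 dvd (i - j)" "h = (\<lambda>(a, b). (real_of_int i - b, real_of_int j - a))"
  | i j :: int where "\<not> e" "3 dvd (i - j)" "h = (\<lambda>(a, b). (real_of_int i - a, a + b + real_of_int j))"
  | i j :: int where "\<not> e" "3 dvd (i - j)" "h = (\<lambda>(a, b). (a + b + real_of_int i, real_of_int j - b))"
  using assms unfolding weyl_def weyl_matrices_def
  by (elim exE conjE) (auto simp: algebra_simps)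

lemma weylI:
  fixes i j :: int
  assumes "3 dvd (i - j)"
  shows "weyl True (\<lambda>(a, b). (a + real_of_int i, b + real_of_int j))" "weyl True (\<lambda>(a, b). (b + real_of_int i, real_of_int j - a - b))"
    "weyl True (\<lambda>(a, b). (real_of_int i - a - b, a + real_of_int j))" "weyl False (\<lambda>(a, b). (real_of_int i - b, real_of_int j - a))"
    "weyl False (\<lambda>(a, b). (real_of_int i - a, a + b + real_of_int j))" "weyl False (\<lambda>(a, b). (a + b + real_of_int i, real_of_int j - b))"
proof -
  have *: "weyl e (\<lambda>(a, b). (real_of_int m * a + n * b + real_of_int i, m' * a + n' * b + real_of_int j))"
    if "(e, m, n, m', n') \<in> weyl_matrices" for e m n m' n'
    unfolding weyl_def using assms that by blast
  show "weyl True (\<lambda>(a, b). (a + real_of_int i, b + real_of_int j))"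
    using *[of True 1 0 0 1] by (simp add: weyl_matrices_def)
  show "weyl True (\<lambda>(a, b). (b + real_of_int i, real_of_int j - a - b))"
    using *[of True 0 1 "-1" "-1"] by (simp add: weyl_matrices_def algebra_simps)
  show "weyl True (\<lambda>(a, b). (real_of_int i - a - b, a + real_of_int j))"
    using *[of True "-1" "-1" 1 0] by (simp add: weyl_matrices_def algebra_simps)
  show "weyl False (\<lambda>(a, b). (real_of_int i - b, real_of_int j - a))"
    using *[of False 0 "-1" "-1" 0] by (simp add: weyl_matrices_def algebra_simps)
  show "weyl False (\<lambda>(a, b). (real_of_int i - a, a + b + real_of_int j))"
    using *[of False "-1" 0 1 1] by (simp add: weyl_matrices_def algebra_simps)
  show "weyl False (\<lambda>(a, b). (a + b + real_of_int i, real_of_int j - b))"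
    using *[of False 1 1 0 "-1"] by (simp add: weyl_matrices_def algebra_simps)
qed

lemma weyl_compose:
  assumes "weyl e h" "weyl e' h'"
  shows "weyl (e = e') (\<lambda>x. h (h' x))"
proof -
  obtain m n m' n' i j where M: "(e, m, n, m', n') \<in> weyl_matrices" and ij: "3 dvd (i - j)"
    and h: "h = (\<lambda>(a, b). (real_of_int m * a + real_of_int n * b + real_of_int i,
      real_of_int m' * a + real_of_int n' * b + real_of_int j))"
    using assms(1) unfolding weyl_def by blast
  obtain r s r' s' k l where R: "(e', r, s, r', s') \<in> weyl_matrices" and kl: "3 dvd (k - l)"
    and h': "h' = (\<lambda>(a, b). (real_of_int r * a + real_of_int s * b + real_of_int k,
      real_of_int r' * a + real_of_int s' * b + real_of_int l))"
    using assms(2) unfolding weyl_def by blast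
  have "(e = e', m * r + n * r', m * s + n * s', m' * r + n' * r', m' * s + n' * s') \<in> weyl_matrices"
    using M R unfolding weyl_matrices_def by (elim insertE emptyE) simp_all
  moreover have "3 dvd ((m * k + n * l + i) - (m' * k + n' * l + j))"
  proof -
    have "3 dvd m + n - (m' + n')" using M by (auto simp: weyl_matrices_def)
    then have "3 dvd (m - m') * (k - l) + (m + n - (m' + n')) * l + (i - j)"
      using ij kl by (intro dvd_add dvd_mult dvd_mult2)
    then show ?thesis by (simp add: algebra_simps)
  qed
  moreover have "(\<lambda>x. h (h' x)) = (\<lambda>(a, b).
      (real_of_int (m * r + n * r') * a + real_of_int (m * s + n * s') * b + real_of_int (m * k + n * l + i),
       real_of_int (m' * r + n' * r') * a + real_of_int (m' * s + n' * s') * b + real_of_int (m' * k + n' * l + j)))"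
    unfolding h h' by (simp add: fun_eq_iff algebra_simps)
  ultimately show ?thesis unfolding weyl_def by blast
qed

lemma dvd_shift:
  fixes i j k l m n c :: int
  assumes "3 dvd (i - j)" "3 dvd (k - l)" "m - n = (k - l) + (i - j) + 3 * c"
  shows "3 dvd (m - n)"
  unfolding assms(3) using assms(1,2) by (intro dvd_add) auto

lemma weyl_inverse:
  assumes "weyl e h"
  obtains h' where "weyl e h'" "\<And>x. h' (h x) = x"
  using assms
proof (cases rule: weyl_cases)
  case (id i j)
  have "3 dvd (- i - - j)" using id(2) by presburger
  from weylI(1)[OF this] id show ?thesis by (intro that) auto
next
  case (rot i j)
  have "3 dvd (i + j - - i)" using rot(2) by presburger
  from weylI(3)[OF this] rot show ?thesis by (intro that) auto
next
  case (rot' i j)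
  have "3 dvd (- j - (i + j))" using rot'(2) by presburger
  from weylI(2)[OF this] rot' show ?thesis by (intro that) auto
next
  case (flip_c i j)
  have "3 dvd (j - i)" using flip_c(2) by presburger
  from weylI(4)[OF this] flip_c show ?thesis by (intro that) auto
next
  case (flip_a i j)
  have "3 dvd (i - (- i - j))" using flip_a(2) by presburger
  from weylI(5)[OF this] flip_a show ?thesis by (intro that) auto
next
  case (flip_b i j)
  have "3 dvd (- i - j - j)" using flip_b(2) by presburger
  from weylI(6)[OF this] flip_b show ?thesis by (intro that) auto
qed

text \<open>Every unit triangle has one edge whose ends have nonzero colours. Joining triangles along these
  edges tiles the plane with the images of the square, so an element of the group that moves an
  interior point of the square into the square maps the square to itself. Among the
  orientation-preserving symmetries of the rhombus only the identity belongs to the group, which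
  contains no half-turns. For reflections the claim fails: the short diagonal is an axis of the
  square.\<close>

lemma weyl_True_fixes_square:
  assumes "weyl True h" "0 < a" "a < 1" "0 < b" "b < 1" "h (a, b) \<in> {0..1} \<times> {0..1}"
  shows "h = (\<lambda>x. x)"
  using assms(1)
proof (cases rule: weyl_cases)
  case (id i j)
  with assms have "i = 0" "j = 0" by auto
  with id show ?thesis by auto
next
  case (rot i j)
  with assms have "i = 0" "0 < j" "j < 3" by auto
  with rot show ?thesis by presburger
next
  case (rot' i j)
  with assms have "j = 0" "0 < i" "i < 3" by auto
  with rot' show ?thesis by presburger
qed auto

text \<open>Under the sign conditions the six images of the vector \<open>(p, q)\<close> are distinct, so that a
  map that preserves the direction of flight is a translation.\<close>

lemma weyl_fixed_direction:
  fixes h :: "real \<times> real \<Rightarrow> real \<times> real"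
  assumes "weyl e h" "d \<noteq> 0" "q < 0" "0 < p + q"
    and "h (a, b) = (a', b')" "h (a + d * p, b + d * q) = (a' + d * p, b' + d * q)"
  obtains i j :: int where e "3 dvd (i - j)" "h = (\<lambda>(a, b). (a + real_of_int i, b + real_of_int j))"
  using assms(1)
proof (cases rule: weyl_cases)
  case (id i j)
  then show ?thesis using that by blast
next
  case (rot i j)
  with assms(5,6) have "d * q = d * p" by auto
  with assms show ?thesis by auto
next
  case (rot' i j)
  with assms(5,6) have "d * p = d * q" by auto
  with assms show ?thesis by auto
next
  case (flip_c i j)
  with assms(5,6) have "d * (p + q) = 0" by (auto simp: algebra_simps)
  with assms show ?thesis by auto
next
  case (flip_a i j)
  with assms(5,6) have "d * p = 0" by (auto simp: algebra_simps)
  with assms show ?thesis by auto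
next
  case (flip_b i j)
  with assms(5,6) have "d * q = 0" by (auto simp: algebra_simps)
  with assms show ?thesis by auto
qed

text \<open>The open lattice edges with an end of the same colour as the acute vertices \<open>(0, 0)\<close>
  and \<open>(1, 1)\<close> of the rhombus. Lattice edges have the directions \<open>(1, 0)\<close>,
  \<open>(0, 1)\<close> and \<open>(1, -1)\<close>, and negative \<open>s\<close> gives the opposite
  edges.\<close>

definition walls :: "(real \<times> real) set" where
  "walls = {(a, b). \<exists>(i :: int) (j :: int) (s :: real). 3 dvd (i - j) \<and> s \<noteq> 0 \<and> \<bar>s\<bar> < 1 \<and>
     ((a, b) = (real_of_int i + s, real_of_int j) \<or> (a, b) = (real_of_int i, real_of_int j + s) \<or>
      (a, b) = (real_of_int i + s, real_of_int j - s))}"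

lemma wallsI:
  fixes i j :: int and s :: real
  assumes "3 dvd (i - j)" "s \<noteq> 0" "\<bar>s\<bar> < 1"
  shows "(i + s, real_of_int j) \<in> walls" "(real_of_int i, j + s) \<in> walls" "(i + s, j - s) \<in> walls"
    "(i - s, real_of_int j) \<in> walls" "(real_of_int i, j - s) \<in> walls" "(i - s, j + s) \<in> walls"
proof -
  have *: "(a, b) \<in> walls" if "r \<noteq> 0" "\<bar>r\<bar> < 1"
    "(a, b) = (i + r, real_of_int j) \<or> (a, b) = (real_of_int i, j + r) \<or> (a, b) = (i + r, j - r)" for a b r :: real
    using assms(1) that unfolding walls_def by blast
  note 1 = *[of s] and 2 = *[of "- s"]
  show "(i + s, real_of_int j) \<in> walls" "(real_of_int i, j + s) \<in> walls" "(i + s, j - s) \<in> walls"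
    using assms 1 by simp_all
  show "(i - s, real_of_int j) \<in> walls" "(real_of_int i, j - s) \<in> walls" "(i - s, j + s) \<in> walls"
    using assms 2 by simp_all
qed

lemma weyl_walls:
  assumes "weyl e h" "x \<in> walls"
  shows "h x \<in> walls"
proof -
  obtain i j :: int and s :: real where ij: "3 dvd (i - j)" and s: "s \<noteq> 0" "\<bar>s\<bar> < 1"
    and x: "x = (real_of_int i + s, real_of_int j) \<or> x = (real_of_int i, real_of_int j + s) \<or> x = (real_of_int i + s, real_of_int j - s)"
    using assms(2) unfolding walls_def by auto
  show ?thesis
    using assms(1)
  proof (cases rule: weyl_cases)
    case (id k l)
    have "3 dvd ((i + k) - (j + l))" by (rule dvd_shift[OF ij id(2), of _ _ "0"]) simp
    from wallsI[OF this s] show ?thesis using id(3) x by (elim disjE) (simp_all add: algebra_simps)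
  next
    case (rot k l)
    have "3 dvd ((j + k) - (l - i - j))" by (rule dvd_shift[OF ij rot(2), of _ _ "j"]) simp
    from wallsI[OF this s] show ?thesis using rot(3) x by (elim disjE) (simp_all add: algebra_simps)
  next
    case (rot' k l)
    have "3 dvd ((k - i - j) - (i + l))" by (rule dvd_shift[OF ij rot'(2), of _ _ "- i"]) simp
    from wallsI[OF this s] show ?thesis using rot'(3) x by (elim disjE) (simp_all add: algebra_simps)
  next
    case (flip_c k l)
    have "3 dvd ((k - j) - (l - i))" by (rule dvd_shift[OF ij flip_c(2), of _ _ "0"]) simp
    from wallsI[OF this s] show ?thesis using flip_c(3) x by (elim disjE) (simp_all add: algebra_simps)
  next
    case (flip_a k l)
    have "3 dvd ((k - i) - (i + j + l))" by (rule dvd_shift[OF ij flip_a(2), of _ _ "- i"]) simp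
    from wallsI[OF this s] show ?thesis using flip_a(3) x by (elim disjE) (simp_all add: algebra_simps)
  next
    case (flip_b k l)
    have "3 dvd ((i + j + k) - (l - j))" by (rule dvd_shift[OF ij flip_b(2), of _ _ "j"]) simp
    from wallsI[OF this s] show ?thesis using flip_b(3) x by (elim disjE) (simp_all add: algebra_simps)
  qed
qed

lemma weyl_walls_iff:
  assumes "weyl e h"
  shows "h x \<in> walls \<longleftrightarrow> x \<in> walls"
  by (metis assms weyl_inverse weyl_walls)

lemma weyl_lattice:
  assumes "weyl e h" "x \<in> \<int> \<times> \<int>"
  shows "h x \<in> \<int> \<times> \<int>"
  using assms by (cases rule: weyl_cases) auto

lemma int_add_frac:
  fixes k i :: int and s :: real
  assumes "real_of_int k = real_of_int i + s" "s \<noteq> 0" "\<bar>s\<bar> < 1"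
  shows False
proof -
  have "k < i + 1" "i < k + 1" using assms by linarith+
  then have "k = i" by simp
  with assms show False by simp
qed

text \<open>The edge through \<open>(k, b)\<close> has the ends \<open>(k, \<lfloor>b\<rfloor>)\<close> and
  \<open>(k, \<lfloor>b\<rfloor> + 1)\<close>, whose colours are \<open>k -
  \<lfloor>b\<rfloor>\<close> and \<open>k - \<lfloor>b\<rfloor> - 1\<close>. One of them vanishes
  modulo 3 unless \<open>k - \<lfloor>b\<rfloor> \<equiv> 2\<close>. The criteria for the other two
  directions follow by a symmetry of the group.\<close>

lemma walls_a_line:
  fixes k :: int
  assumes "b \<notin> \<int>"
  shows "(real_of_int k, b) \<in> walls \<longleftrightarrow> (k - \<lfloor>b\<rfloor>) mod 3 \<noteq> 2"
proof
  assume "(real_of_int k, b) \<in> walls"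
  then obtain i j :: int and s :: real where ij: "3 dvd (i - j)" "s \<noteq> 0" "\<bar>s\<bar> < 1"
    and "(real_of_int k, b) = (real_of_int i + s, real_of_int j) \<or> (real_of_int k, b) = (real_of_int i, real_of_int j + s)
       \<or> (real_of_int k, b) = (real_of_int i + s, real_of_int j - s)"
    unfolding walls_def by auto
  with assms int_add_frac[of k i s] have "k = i" "b = j + s" by auto
  have "\<lfloor>b\<rfloor> = j \<or> \<lfloor>b\<rfloor> = j - 1" using \<open>b = j + s\<close> ij by linarith
  then show "(k - \<lfloor>b\<rfloor>) mod 3 \<noteq> 2" using ij(1) unfolding \<open>k = i\<close> by presburger
next
  assume *: "(k - \<lfloor>b\<rfloor>) mod 3 \<noteq> 2"
  have f: "frac b > 0" "frac b < 1" using assms by (auto simp: frac_gt_0_iff frac_lt_1)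
  from * have "3 dvd (k - \<lfloor>b\<rfloor>) \<or> 3 dvd (k - (\<lfloor>b\<rfloor> + 1))" by presburger
  then show "(real_of_int k, b) \<in> walls"
  proof
    assume "3 dvd (k - \<lfloor>b\<rfloor>)"
    from wallsI(2)[OF this, of "frac b"] f show ?thesis by (simp add: frac_def)
  next
    assume "3 dvd (k - (\<lfloor>b\<rfloor> + 1))"
    from wallsI(2)[OF this, of "frac b - 1"] f show ?thesis by (simp add: frac_def)
  qed
qed

lemma weyl_swap_walls:
  fixes a b :: real
  shows "(- b, - a) \<in> walls \<longleftrightarrow> (a, b) \<in> walls"
  using weyl_walls_iff[OF weylI(4)[of 0 0], of "(a, b)"] by simp

lemma walls_b_line:
  fixes j :: int
  assumes "a \<notin> \<int>"
  shows "(a, real_of_int j) \<in> walls \<longleftrightarrow> (\<lfloor>a\<rfloor> - j) mod 3 \<noteq> 1"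
proof -
  have "(a, real_of_int j) \<in> walls \<longleftrightarrow> (real_of_int (- j), - a) \<in> walls"
    using weyl_swap_walls[of "real_of_int j" a] by simp
  also have "\<dots> \<longleftrightarrow> (- j - \<lfloor>- a\<rfloor>) mod 3 \<noteq> 2"
    using assms by (intro walls_a_line) simp
  also have "\<lfloor>- a\<rfloor> = - \<lfloor>a\<rfloor> - 1"
    using assms by (simp add: floor_minus ceiling_altdef) (metis Ints_of_int)
  also have "(- j - (- \<lfloor>a\<rfloor> - 1)) mod 3 \<noteq> 2 \<longleftrightarrow> (\<lfloor>a\<rfloor> - j) mod 3 \<noteq> 1" by presburger
  finally show ?thesis .
qed

lemma walls_c_line:
  fixes c :: int
  assumes "a \<notin> \<int>" "a + b = real_of_int c"
  shows "(a, b) \<in> walls \<longleftrightarrow> (2 * \<lfloor>a\<rfloor> - c) mod 3 \<noteq> 2"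
proof -
  have "(a, b) \<in> walls \<longleftrightarrow> (- a, a + b) \<in> walls"
    using weyl_walls_iff[OF weylI(5)[of 0 0], of "(a, b)"] by simp
  also have "\<dots> \<longleftrightarrow> (\<lfloor>- a\<rfloor> - c) mod 3 \<noteq> 1"
    using assms by (simp add: walls_b_line)
  also have "\<lfloor>- a\<rfloor> = - \<lfloor>a\<rfloor> - 1"
    using assms by (simp add: floor_minus ceiling_altdef) (metis Ints_of_int)
  also have "(- \<lfloor>a\<rfloor> - 1 - c) mod 3 \<noteq> 1 \<longleftrightarrow> (2 * \<lfloor>a\<rfloor> - c) mod 3 \<noteq> 2"
  proof -
    have "2 * \<lfloor>a\<rfloor> - c = (- \<lfloor>a\<rfloor> - 1 - c) + 1 + 3 * \<lfloor>a\<rfloor>" by simp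
    moreover have "m mod 3 \<noteq> 1 \<longleftrightarrow> (m + 1 + 3 * f) mod 3 \<noteq> 2" for m f :: int by presburger
    ultimately show ?thesis by metis
  qed
  finally show ?thesis .
qed

lemma walls_on_line:
  assumes "(a, b) \<in> walls"
  shows "a \<in> \<int> \<or> b \<in> \<int> \<or> a + b \<in> \<int>"
  using assms unfolding walls_def by auto

lemma walls_disjoint_open_square:
  assumes "0 < a" "a < 1" "0 < b" "b < 1"
  shows "(a, b) \<notin> walls"
proof
  assume "(a, b) \<in> walls"
  then obtain i j :: int and s :: real where ij: "3 dvd (i - j)" "s \<noteq> 0" "\<bar>s\<bar> < 1"
    and "(a, b) = (real_of_int i + s, real_of_int j) \<or> (a, b) = (real_of_int i, real_of_int j + s) \<or> (a, b) = (real_of_int i + s, real_of_int j - s)"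
    unfolding walls_def by auto
  with assms have ab: "a = real_of_int i + s" "b = real_of_int j - s" by auto
  have "0 \<le> i" "i \<le> 1" "0 \<le> j" "j \<le> 1" "0 < i + j" "i + j < 2" using ab assms ij by linarith+
  with ij show False by presburger
qed

section \<open>Walls met between consecutive lattice lines\<close>

lemma int_between:
  fixes x :: real and j :: int
  assumes "x \<in> \<int>" "real_of_int j < x" "x < real_of_int (j + 2)"
  shows "x = real_of_int (j + 1)"
proof -
  obtain i where i: "x = real_of_int i" using assms(1) by (rule Ints_cases)
  with assms have "j < i" "i < j + 2" by linarith+
  with i show ?thesis by simp
qed

lemma not_int_between:
  fixes x :: real and j :: int
  assumes "real_of_int j < x" "x < real_of_int (j + 1)"
  shows "x \<notin> \<int>"
  using int_between[of x j] assms by fastforce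

text \<open>The line moves from \<open>(k, b)\<close> to \<open>(k + 1, b - \<delta>)\<close>. The end of the
  step lies on the line \<open>a = k + 1\<close>, and one further edge is crossed on the way: if
  \<open>\<delta>\<close> is less than the fractional part of \<open>b\<close>, it lies on \<open>a
  + b = k + \<lfloor>b\<rfloor> + 1\<close>, and otherwise on \<open>b =
  \<lfloor>b\<rfloor>\<close>. In either case exactly one of the two crossings misses the walls,
  unless the colour \<open>k - \<lfloor>b\<rfloor>\<close> of the first edge is 2, in which case
  both are walls. The hypothesis \<open>b - \<delta> \<notin> \<int>\<close> says that the line does
  not run into a lattice point.\<close>

lemma card_walls_strip:
  fixes k :: int and b \<delta> :: real
  assumes "b \<notin> \<int>" "b - \<delta> \<notin> \<int>" "0 < \<delta>" "\<delta> < 1"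
  defines "W \<equiv> {\<theta> \<in> {0<..1::real}. (real_of_int k + \<theta>, b - \<delta> * \<theta>) \<in> walls}"
  shows "finite W \<and> card W = 1 + (if (k - \<lfloor>b\<rfloor>) mod 3 = 2 then 1 else 0)"
proof -
  define j where "j = \<lfloor>b\<rfloor>"
  define f where "f = frac b"
  define v where "v = (k - j) mod 3"
  have b: "b = j + f" by (simp add: j_def f_def frac_def)
  have f: "0 < f" "f < 1" using assms by (auto simp: f_def frac_lt_1)
  have v: "v \<in> {0, 1, 2}" by (auto simp: v_def)
  have "f \<noteq> \<delta>" using assms(2) b by auto
  have k: "real_of_int k + \<theta> \<notin> \<int>" "\<lfloor>real_of_int k + \<theta>\<rfloor> = k" if "0 < \<theta>" "\<theta> < 1" for \<theta>
  proof -
    show "real_of_int k + \<theta> \<notin> \<int>" using that not_int_between[of 0 \<theta>] by simp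
    show "\<lfloor>real_of_int k + \<theta>\<rfloor> = k" by (rule floor_unique) (use that in simp_all)
  qed
  \<comment> \<open>\<open>u\<close> and \<open>w\<close> are the colours for which the intermediate and the final crossing are not walls.\<close>
  have two: "finite W \<and> card W = 1 + (if v = 2 then 1 else 0)"
    if "0 < c" "c < 1" "\<And>\<theta>. \<theta> \<in> W \<longleftrightarrow> \<theta> = c \<and> v \<noteq> u \<or> \<theta> = 1 \<and> v \<noteq> w" "{u, w} = {0, 1}" for c :: real and u w :: int
  proof -
    have W: "W = (if v = u then {} else {c}) \<union> (if v = w then {} else {1})"
      unfolding set_eq_iff that(3) by simp
    have "c \<noteq> 1" "u = 0 \<and> w = 1 \<or> u = 1 \<and> w = 0"
      using that(2,4) by (auto simp: doubleton_eq_iff)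
    then show ?thesis unfolding W using v by (elim insertE emptyE disjE conjE) simp_all
  qed
  show ?thesis unfolding j_def[symmetric] v_def[symmetric]
  proof (cases "\<delta> < f")
    case True
    define c where "c = (1 - f) / (1 - \<delta>)"
    have c: "0 < c" "c < 1" "c * (1 - \<delta>) = 1 - f" using True f assms(3,4) by (auto simp: c_def)
    show "finite W \<and> card W = 1 + (if v = 2 then 1 else 0)"
    proof (rule two[of c 0 1])
      fix \<theta>
      show "\<theta> \<in> W \<longleftrightarrow> \<theta> = c \<and> v \<noteq> 0 \<or> \<theta> = 1 \<and> v \<noteq> 1"
      proof (cases "0 < \<theta> \<and> \<theta> < 1")
        case t: True
        have "\<delta> * \<theta> \<le> \<delta> * 1" "0 < \<delta> * \<theta>" using t assms(3) by (auto intro: mult_left_mono)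
        then have nb: "b - \<delta> * \<theta> \<notin> \<int>" using b f True by (intro not_int_between[of j]) auto
        have m: "0 < \<theta> * (1 - \<delta>)" "\<theta> * (1 - \<delta>) < 1 * (1 - \<delta>)"
          using t assms(4) by (auto intro: mult_strict_right_mono)
        have s: "real_of_int k + \<theta> + (b - \<delta> * \<theta>) = real_of_int (k + j) + (f + \<theta> * (1 - \<delta>))"
          by (simp add: b algebra_simps)
        have c1: "\<theta> = c" if "real_of_int k + \<theta> + (b - \<delta> * \<theta>) \<in> \<int>"
        proof -
          have "real_of_int k + \<theta> + (b - \<delta> * \<theta>) = real_of_int (k + j + 1)"
            using that by (rule int_between) (use s m f assms(3) in auto)
          then have "\<theta> * (1 - \<delta>) = c * (1 - \<delta>)" using s c(3) by simp
          then show ?thesis using assms(4) by simp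
        qed
        have c2: "(real_of_int k + c, b - \<delta> * c) \<in> walls \<longleftrightarrow> (2 * \<lfloor>real_of_int k + c\<rfloor> - (k + j + 1)) mod 3 \<noteq> 2"
          by (rule walls_c_line) (use k(1)[of c] c b in \<open>auto simp: algebra_simps\<close>)
        also have "\<lfloor>real_of_int k + c\<rfloor> = k" using k c by blast
        also have "(2 * k - (k + j + 1)) mod 3 \<noteq> 2 \<longleftrightarrow> v \<noteq> 0" unfolding v_def by presburger
        finally have c2: "(real_of_int k + c, b - \<delta> * c) \<in> walls \<longleftrightarrow> v \<noteq> 0" .
        have "\<theta> \<in> W \<longleftrightarrow> (real_of_int k + \<theta>, b - \<delta> * \<theta>) \<in> walls" using t by (simp add: W_def)
        also have "\<dots> \<longleftrightarrow> \<theta> = c \<and> v \<noteq> 0"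
          using walls_on_line k(1)[of \<theta>] t nb c1 c2 by blast
        finally show ?thesis using t by auto
      next
        case False
        have "(real_of_int (k + 1), b - \<delta>) \<in> walls \<longleftrightarrow> (k + 1 - \<lfloor>b - \<delta>\<rfloor>) mod 3 \<noteq> 2"
          using walls_a_line[OF assms(2), of "k + 1"] by simp
        also have "\<lfloor>b - \<delta>\<rfloor> = j" using b f assms(3,4) True by (intro floor_unique) auto
        also have "(k + 1 - j) mod 3 \<noteq> 2 \<longleftrightarrow> v \<noteq> 1" unfolding v_def by presburger
        finally show ?thesis using False c by (auto simp: W_def)
      qed
    qed (use c in auto)
  next
    case False
    with \<open>f \<noteq> \<delta>\<close> have "f < \<delta>" by simp
    define c where "c = f / \<delta>"
    have c: "0 < c" "c < 1" "\<delta> * c = f" using \<open>f < \<delta>\<close> f assms(3,4) by (auto simp: c_def)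
    show "finite W \<and> card W = 1 + (if v = 2 then 1 else 0)"
    proof (rule two[of c 1 0])
      fix \<theta>
      show "\<theta> \<in> W \<longleftrightarrow> \<theta> = c \<and> v \<noteq> 1 \<or> \<theta> = 1 \<and> v \<noteq> 0"
      proof (cases "0 < \<theta> \<and> \<theta> < 1")
        case t: True
        have m: "\<delta> * \<theta> \<le> \<delta> * 1" "0 < \<delta> * \<theta>" using t assms(3) by (auto intro: mult_left_mono)
        have c1: "\<theta> = c" if "b - \<delta> * \<theta> \<in> \<int>"
        proof -
          have "b - \<delta> * \<theta> = real_of_int ((j - 1) + 1)"
            using that by (rule int_between) (use m f assms(4) b in auto)
          then have "\<delta> * \<theta> = \<delta> * c" unfolding c(3) using b by linarith
          then show ?thesis using assms(3) by simp
        qed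
        have m': "0 < \<theta> * (1 - \<delta>)" "\<theta> * (1 - \<delta>) < 1 * (1 - \<delta>)"
          using t assms(4) by (auto intro: mult_strict_right_mono)
        have "real_of_int k + \<theta> + (b - \<delta> * \<theta>) = real_of_int (k + j) + (f + \<theta> * (1 - \<delta>))"
          by (simp add: b algebra_simps)
        then have ns: "real_of_int k + \<theta> + (b - \<delta> * \<theta>) \<notin> \<int>"
          using m' f \<open>f < \<delta>\<close> by (intro not_int_between[of "k + j"]) auto
        have "(real_of_int k + c, real_of_int j) \<in> walls \<longleftrightarrow> (\<lfloor>real_of_int k + c\<rfloor> - j) mod 3 \<noteq> 1"
          by (rule walls_b_line) (use k(1)[of c] c in auto)
        also have "\<lfloor>real_of_int k + c\<rfloor> = k" using k c by blast
        also have "(k - j) mod 3 \<noteq> 1 \<longleftrightarrow> v \<noteq> 1" unfolding v_def by presburger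
        finally have c2: "(real_of_int k + c, b - \<delta> * c) \<in> walls \<longleftrightarrow> v \<noteq> 1" using b c by simp
        have "\<theta> \<in> W \<longleftrightarrow> (real_of_int k + \<theta>, b - \<delta> * \<theta>) \<in> walls" using t by (simp add: W_def)
        also have "\<dots> \<longleftrightarrow> \<theta> = c \<and> v \<noteq> 1"
          using walls_on_line k(1)[of \<theta>] t ns c1 c2 by blast
        finally show ?thesis using t by auto
      next
        case False
        have "(real_of_int (k + 1), b - \<delta>) \<in> walls \<longleftrightarrow> (k + 1 - \<lfloor>b - \<delta>\<rfloor>) mod 3 \<noteq> 2"
          using walls_a_line[OF assms(2), of "k + 1"] by simp
        also have "\<lfloor>b - \<delta>\<rfloor> = j - 1" using b f assms(3,4) \<open>f < \<delta>\<close> by (intro floor_unique) auto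
        also have "(k + 1 - (j - 1)) mod 3 \<noteq> 2 \<longleftrightarrow> v \<noteq> 0" unfolding v_def by presburger
        finally show ?thesis using False c by (auto simp: W_def)
      qed
    qed (use c in auto)
  qed
qed

section \<open>Equidistribution and periodic counting\<close>

text \<open>Up to a constant, the quantity \<open>k - (\<theta> + k (p - 3 D) / p)\<close> is \<open>3 (D k /
  p)\<close>. Since \<open>D\<close> is invertible modulo \<open>p\<close>, for \<open>k = 1,
  \<dots>, p\<close> it takes, modulo 3, the values of \<open>p\<close> equally spaced points. A
  third of the circle contains \<open>p / 3\<close> of these, rounded up or down.\<close>

lemma card_stripe:
  fixes p D :: int and \<theta> :: real
  assumes "0 < p" "coprime p D"
  shows "card {k \<in> {1..p}. (k - \<lfloor>\<theta> + k * (p - 3 * D) / p\<rfloor>) mod 3 = 2} \<in> {nat (p div 3), nat ((p + 2) div 3)}"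
proof -
  \<comment> \<open>\<open>f k\<close> numbers the equally spaced points, and \<open>n\<close> is the offset of the first one in units of \<open>1 / p\<close>.\<close>
  define N where "N = \<lfloor>p * \<theta>\<rfloor>"
  define n where "n = N mod 3"
  define f where "f k = (N div 3 - D * k) mod p" for k
  have fl: "\<lfloor>\<theta> + k * (p - 3 * D) / p\<rfloor> = k + (N - 3 * (D * k)) div p" for k :: int
  proof -
    have "\<theta> + k * (p - 3 * D) / p = (p * \<theta> + of_int (k * (p - 3 * D))) / p"
      using assms by (simp add: field_simps)
    also have "\<lfloor>\<dots>\<rfloor> = \<lfloor>p * \<theta> + of_int (k * (p - 3 * D))\<rfloor> div p"
      using assms by (intro floor_divide_real_eq_div) auto
    also have "\<lfloor>p * \<theta> + of_int (k * (p - 3 * D))\<rfloor> = N + k * (p - 3 * D)"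
      unfolding N_def by linarith
    also have "N + k * (p - 3 * D) = (N - 3 * (D * k)) + k * p" by (simp add: algebra_simps)
    also have "\<dots> div p = k + (N - 3 * (D * k)) div p" using assms by simp
    finally show ?thesis .
  qed
  have cond: "(k - \<lfloor>\<theta> + k * (p - 3 * D) / p\<rfloor>) mod 3 = 2 \<longleftrightarrow> p \<le> 3 * f k + n \<and> 3 * f k + n < 2 * p" for k
  proof -
    define M where "M = N - 3 * (D * k)"
    define c where "c = (N div 3 - D * k) div p"
    have "N = 3 * (N div 3) + n" by (simp add: n_def)
    moreover have "N div 3 - D * k = c * p + f k" by (simp add: c_def f_def)
    ultimately have M: "M = (3 * f k + n) + (3 * c) * p" by (simp add: M_def algebra_simps)
    have f: "0 \<le> f k" "f k < p" "0 \<le> n" "n \<le> 2" using assms by (auto simp: f_def n_def)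
    define g where "g = (3 * f k + n) div p"
    have g: "g * p \<le> 3 * f k + n" "3 * f k + n < (g + 1) * p"
      using div_mult_mod_eq[of "3 * f k + n" p] pos_mod_sign[OF assms(1), of "3 * f k + n"]
        pos_mod_bound[OF assms(1), of "3 * f k + n"] unfolding g_def distrib_right by linarith+
    have "g \<ge> 0" using f assms by (simp add: g_def pos_imp_zdiv_nonneg_iff)
    have "g < 3" 
    proof (rule ccontr)
      assume "\<not> g < 3"
      then have "3 * p \<le> g * p" using assms by (intro mult_right_mono) auto
      with g f show False by linarith
    qed
    have "M div p = g + 3 * c" using M assms by (simp add: g_def)
    then have "(k - \<lfloor>\<theta> + k * (p - 3 * D) / p\<rfloor>) mod 3 = 2 \<longleftrightarrow> (- (g + 3 * c)) mod 3 = 2"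
      unfolding fl M_def[symmetric] by simp
    also have "\<dots> \<longleftrightarrow> g = 1" using \<open>g \<ge> 0\<close> \<open>g < 3\<close> by presburger
    also have "\<dots> \<longleftrightarrow> p \<le> 3 * f k + n \<and> 3 * f k + n < 2 * p"
    proof
      assume "g = 1" then show "p \<le> 3 * f k + n \<and> 3 * f k + n < 2 * p" using g by auto
    next
      assume "p \<le> 3 * f k + n \<and> 3 * f k + n < 2 * p"
      then show "g = 1" unfolding g_def using assms
        by (intro int_div_pos_eq[where r = "3 * f k + n - p"]) auto
    qed
    finally show ?thesis .
  qed
  have inj: "inj_on f {1..p}"
  proof (rule inj_onI)
    fix k k' assume k: "k \<in> {1..p}" "k' \<in> {1..p}" and "f k = f k'"
    then have "p dvd (N div 3 - D * k) - (N div 3 - D * k')"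
      unfolding f_def by (simp only: mod_eq_dvd_iff)
    then have "p dvd D * (k' - k)" by (simp add: algebra_simps)
    then have "p dvd k' - k" using assms by (simp add: coprime_dvd_mult_right_iff)
    moreover have "\<bar>k' - k\<bar> < p" using k by auto
    ultimately show "k = k'" using zdvd_imp_le[of p "\<bar>k' - k\<bar>"] by fastforce
  qed
  have "f ` {1..p} \<subseteq> {0..<p}" using assms by (auto simp: f_def)
  then have img: "f ` {1..p} = {0..<p}"
    using card_image[OF inj] by (intro card_subset_eq) auto
  have "card {k \<in> {1..p}. (k - \<lfloor>\<theta> + k * (p - 3 * D) / p\<rfloor>) mod 3 = 2}
      = card (f ` {k \<in> {1..p}. p \<le> 3 * f k + n \<and> 3 * f k + n < 2 * p})"
    unfolding cond by (rule card_image[symmetric]) (rule inj_on_subset[OF inj], auto)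
  also have "f ` {k \<in> {1..p}. p \<le> 3 * f k + n \<and> 3 * f k + n < 2 * p}
      = {r \<in> f ` {1..p}. p \<le> 3 * r + n \<and> 3 * r + n < 2 * p}" by auto
  also have "\<dots> = {(p - n + 2) div 3..<(2 * p - n + 2) div 3}"
  proof -
    have ge: "(u + 2) div 3 \<le> r \<longleftrightarrow> u \<le> 3 * r" for u r :: int by presburger
    have lt: "r < (2 * p - n + 2) div 3 \<longleftrightarrow> 3 * r < 2 * p - n" for r
      by (simp only: not_le[symmetric] ge)
    have n: "0 \<le> n" "n \<le> 2" by (auto simp: n_def)
    show ?thesis
      unfolding img set_eq_iff mem_Collect_eq atLeastLessThan_iff ge lt using assms(1) n by auto
  qed
  also have "card \<dots> = nat ((2 * p - n + 2) div 3 - (p - n + 2) div 3)" by simp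
  also have "\<dots> \<in> {nat (p div 3), nat ((p + 2) div 3)}"
  proof -
    define m where "m = p div 3"
    define r where "r = p mod 3"
    have div3: "(3 * u + c) div 3 = u + c div 3" for u c :: int by simp
    have shift: "u - v \<in> {m, w}" if "u = 2 * m + a" "v = m + b" "w = m + c" "a - b \<in> {0, c}"
      for u v w a b c :: int using that by auto
    have p: "p = 3 * m + r" by (simp add: m_def r_def)
    have "(2 * p - n + 2) div 3 = 2 * m + (2 * r - n + 2) div 3"
      using div3[of "2 * m" "2 * r - n + 2"] unfolding p by (simp only: algebra_simps)
    moreover have "(p - n + 2) div 3 = m + (r - n + 2) div 3"
      using div3[of m "r - n + 2"] unfolding p by (simp only: algebra_simps)
    moreover have "(p + 2) div 3 = m + (r + 2) div 3"
      using div3[of m "r + 2"] unfolding p by (simp only: algebra_simps)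
    moreover have "(2 * r - n + 2) div 3 - (r - n + 2) div 3 \<in> {0, (r + 2) div 3}"
    proof -
      have "r \<in> {0, 1, 2}" "n \<in> {0, 1, 2}" unfolding r_def n_def by auto
      then show ?thesis by (elim insertE emptyE; hypsubst; simp)
    qed
    ultimately have "(2 * p - n + 2) div 3 - (p - n + 2) div 3 \<in> {p div 3, (p + 2) div 3}"
      unfolding m_def[symmetric] by (rule shift)
    then show ?thesis by (elim insertE emptyE) (simp_all only: insert_iff simp_thms)
  qed
  finally show ?thesis .
qed

text \<open>Reducing modulo \<open>T\<close> into the other window is injective, in both directions.\<close>

lemma card_periodic_window:
  fixes X :: "real set"
  assumes "0 < T" and per: "\<And>t. t + T \<in> X \<longleftrightarrow> t \<in> X"
    and fin: "finite (X \<inter> {c<..c + T})" "finite (X \<inter> {d<..d + T})"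
  shows "card (X \<inter> {c<..c + T}) = card (X \<inter> {d<..d + T})"
proof -
  have per_nat: "t + of_nat n * T \<in> X \<longleftrightarrow> t \<in> X" for t n
  proof (induction n)
    case (Suc n)
    have "t + of_nat (Suc n) * T = (t + of_nat n * T) + T" by (simp add: algebra_simps)
    with Suc show ?case by (metis per)
  qed simp
  have per_int: "t - of_int k * T \<in> X \<longleftrightarrow> t \<in> X" for t k
  proof (cases "k \<ge> 0")
    case True
    then show ?thesis using per_nat[of "t - of_int k * T" "nat k"] by simp
  next
    case False
    then show ?thesis using per_nat[of t "nat (- k)"] by simp
  qed
  have le: "card (X \<inter> {c<..c + T}) \<le> card (X \<inter> {d<..d + T})"
    if "finite (X \<inter> {d<..d + T})" for c d
  proof -
    define f where "f t = t - of_int (\<lceil>(t - d) / T\<rceil> - 1) * T" for t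
    have "inj_on f (X \<inter> {c<..c + T})"
    proof (rule inj_onI)
      fix s t assume st: "s \<in> X \<inter> {c<..c + T}" "t \<in> X \<inter> {c<..c + T}" "f s = f t"
      define k where "k = \<lceil>(s - d) / T\<rceil> - \<lceil>(t - d) / T\<rceil>"
      have k: "s - t = of_int k * T" using st(3) by (simp add: f_def k_def algebra_simps)
      have "\<bar>of_int k * T\<bar> < 1 * T" unfolding k[symmetric] using st by auto
      then have "\<bar>k\<bar> < 1" using \<open>0 < T\<close> by (simp add: abs_mult)
      then show "s = t" using k by simp
    qed
    moreover have "f ` (X \<inter> {c<..c + T}) \<subseteq> X \<inter> {d<..d + T}"
    proof safe
      fix t assume "t \<in> X"
      then show "f t \<in> X" unfolding f_def by (simp only: per_int)
    next
      fix t
      define c where "c = real_of_int \<lceil>(t - d) / T\<rceil>"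
      have "c - 1 < (t - d) / T" "(t - d) / T \<le> c" unfolding c_def by linarith+
      then have "(c - 1) * T < t - d" "t - d \<le> c * T"
        using \<open>0 < T\<close> by (auto simp: field_simps)
      moreover have "f t = t - (c - 1) * T" by (simp add: f_def c_def)
      ultimately show "f t \<in> {d<..d + T}" by (auto simp: algebra_simps)
    qed
    ultimately show ?thesis using that by (rule card_inj_on_le)
  qed
  show ?thesis using le[OF fin(1)] le[OF fin(2)] by (rule antisym[rotated])
qed

section \<open>The unit square with skew reflections\<close>

definition open_square :: "(real \<times> real) set" where
  "open_square = {0<..<1} \<times> {0<..<1}"

definition square_sides :: "(real \<times> real) set" where
  "square_sides = {0..1} \<times> {0..1} - open_square"

text \<open>\<open>side_reflection R x\<close> says that \<open>x\<close> lies in the interior of a side of the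
  square and that \<open>R\<close> is the reflection of the equilateral lattice in that side. In
  these coordinates it is a skew reflection.\<close>

definition side_reflection :: "(real \<times> real \<Rightarrow> real \<times> real) \<Rightarrow> real \<times> real \<Rightarrow> bool" where
  "side_reflection R = (\<lambda>(a, b).
     (a = 0 \<and> 0 < b \<and> b < 1 \<and> R = (\<lambda>(a, b). (- a, a + b))) \<or>
     (a = 1 \<and> 0 < b \<and> b < 1 \<and> R = (\<lambda>(a, b). (2 - a, a + b - 1))) \<or>
     (b = 0 \<and> 0 < a \<and> a < 1 \<and> R = (\<lambda>(a, b). (a + b, - b))) \<or>
     (b = 1 \<and> 0 < a \<and> a < 1 \<and> R = (\<lambda>(a, b). (a + b - 1, 2 - b))))"

lemma side_reflection_weyl:
  assumes "side_reflection R x"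
  shows "weyl False R"
  using assms weylI(5)[of 0 0] weylI(5)[of 2 "-1"] weylI(6)[of 0 0] weylI(6)[of "-1" 2]
  by (auto simp: side_reflection_def)

lemma side_reflection_walls:
  assumes "side_reflection R x"
  shows "x \<in> walls"
proof -
  obtain a b where x: "x = (a, b)" by (cases x)
  show ?thesis
    using assms wallsI(2)[of 0 0 b] wallsI(2)[of 1 1 "b - 1"] wallsI(1)[of 0 0 a] wallsI(1)[of 1 1 "a - 1"]
    by (auto simp: side_reflection_def x)
qed

lemma side_reflection_sides:
  assumes "side_reflection R x"
  shows "x \<in> square_sides" "x \<notin> \<int> \<times> \<int>"
  using assms not_int_between[of 0]
  by (auto simp: side_reflection_def square_sides_def open_square_def)

text \<open>At the strike the coordinate that measures the distance from the side has a nonzero slope, because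
  it was nonzero before. The reflection reverses its sign. The other coordinate has room to both
  sides, since a strike is not at a vertex.\<close>

lemma side_reflection_enters:
  fixes c d u v :: real
  assumes "t1 < t2" and x: "x = (\<lambda>t. (c + t * u, d + t * v))"
    and "x t1 \<in> open_square" "side_reflection R (x t2)"
  shows "\<forall>\<^sub>F t in at_right t2. R (x t) \<in> open_square"
proof -
  have lim: "((\<lambda>t. c + t * u) \<longlongrightarrow> c + t2 * u) (at_right t2)"
    "((\<lambda>t. d + t * v) \<longlongrightarrow> d + t2 * v) (at_right t2)"
    "((\<lambda>t. c + t * u + (d + t * v)) \<longlongrightarrow> c + t2 * u + (d + t2 * v)) (at_right t2)"
    by (auto intro!: tendsto_intros)
  note ev = lim[THEN order_tendstoD(1)] lim[THEN order_tendstoD(2)]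
  have gt: "\<forall>\<^sub>F t in at_right t2. t2 < t" by (simp add: eventually_at_right_less)
  have slope: "e + t1 * w < e + t2 * w \<longleftrightarrow> 0 < w" "e + t2 * w < e + t1 * w \<longleftrightarrow> w < 0" for e w :: real
    using \<open>t1 < t2\<close> by (auto simp: mult_less_cancel_right)
  have up: "e + t2 * w < e + t * w" if "0 < w" "t2 < t" for e w t :: real
    using that by simp
  have down: "e + t * w < e + t2 * w" if "w < 0" "t2 < t" for e w t :: real
    using that by simp
  consider "c + t2 * u = 0" "0 < d + t2 * v" "d + t2 * v < 1" "R = (\<lambda>(a, b). (- a, a + b))"
    | "c + t2 * u = 1" "0 < d + t2 * v" "d + t2 * v < 1" "R = (\<lambda>(a, b). (2 - a, a + b - 1))"
    | "d + t2 * v = 0" "0 < c + t2 * u" "c + t2 * u < 1" "R = (\<lambda>(a, b). (a + b, - b))"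
    | "d + t2 * v = 1" "0 < c + t2 * u" "c + t2 * u < 1" "R = (\<lambda>(a, b). (a + b - 1, 2 - b))"
    using assms(4) unfolding x side_reflection_def by auto
  then show ?thesis
  proof cases
    case 1
    with assms(3) have "u < 0" using slope(2)[of c u] by (auto simp: x open_square_def)
    have "\<forall>\<^sub>F t in at_right t2. c + t * u < 0"
      using gt by eventually_elim (use 1(1) down[OF \<open>u < 0\<close>, of _ c] in metis)
    moreover have "\<forall>\<^sub>F t in at_right t2. - 1 < c + t * u"
      "\<forall>\<^sub>F t in at_right t2. 0 < c + t * u + (d + t * v)"
      "\<forall>\<^sub>F t in at_right t2. c + t * u + (d + t * v) < 1"
      by (rule ev; use 1 in simp)+
    ultimately show ?thesis by eventually_elim (simp add: x open_square_def 1(4))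
  next
    case 2
    with assms(3) have "0 < u" using slope(1)[of c u] by (auto simp: x open_square_def)
    have "\<forall>\<^sub>F t in at_right t2. c + t * u > 1"
      using gt by eventually_elim (use 2(1) up[OF \<open>0 < u\<close>, of _ c] in metis)
    moreover have "\<forall>\<^sub>F t in at_right t2. c + t * u < 2"
      "\<forall>\<^sub>F t in at_right t2. 1 < c + t * u + (d + t * v)"
      "\<forall>\<^sub>F t in at_right t2. c + t * u + (d + t * v) < 2"
      by (rule ev; use 2 in simp)+
    ultimately show ?thesis by eventually_elim (simp add: x open_square_def 2(4))
  next
    case 3
    with assms(3) have "v < 0" using slope(2)[of d v] by (auto simp: x open_square_def)
    have "\<forall>\<^sub>F t in at_right t2. d + t * v < 0"
      using gt by eventually_elim (use 3(1) down[OF \<open>v < 0\<close>, of _ d] in metis)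
    moreover have "\<forall>\<^sub>F t in at_right t2. - 1 < d + t * v"
      "\<forall>\<^sub>F t in at_right t2. 0 < c + t * u + (d + t * v)"
      "\<forall>\<^sub>F t in at_right t2. c + t * u + (d + t * v) < 1"
      by (rule ev; use 3 in simp)+
    ultimately show ?thesis by eventually_elim (simp add: x open_square_def 3(4))
  next
    case 4
    with assms(3) have "0 < v" using slope(1)[of d v] by (auto simp: x open_square_def)
    have "\<forall>\<^sub>F t in at_right t2. d + t * v > 1"
      using gt by eventually_elim (use 4(1) up[OF \<open>0 < v\<close>, of _ d] in metis)
    moreover have "\<forall>\<^sub>F t in at_right t2. d + t * v < 2"
      "\<forall>\<^sub>F t in at_right t2. 1 < c + t * u + (d + t * v)"
      "\<forall>\<^sub>F t in at_right t2. c + t * u + (d + t * v) < 2"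
      by (rule ev; use 4 in simp)+
    ultimately show ?thesis by eventually_elim (simp add: x open_square_def 4(4))
  qed
qed

lemma stays_in_open_square:
  fixes x :: "real \<Rightarrow> real \<times> real"
  assumes cont: "continuous_on {c<..<d} x" and off: "\<And>t. t \<in> {c<..<d} \<Longrightarrow> x t \<notin> square_sides"
    and "s \<in> {c<..<d}" "x s \<in> open_square" "t \<in> {c<..<d}"
  shows "x t \<in> open_square"
proof (rule ccontr)
  assume t: "x t \<notin> open_square"
  \<comment> \<open>The distance from the centre in the norm whose unit sphere is the boundary of the square. By connectedness a path meets the boundary if it passes from below 1 to above 1.\<close>
  define r where "r t = max \<bar>2 * fst (x t) - 1\<bar> \<bar>2 * snd (x t) - 1\<bar>" for t
  have r: "x t \<in> open_square \<longleftrightarrow> r t < 1" "x t \<in> square_sides \<longleftrightarrow> r t = 1" for t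
    by (cases "x t"; auto simp: r_def open_square_def square_sides_def)+
  have "continuous_on {c<..<d} r" unfolding r_def using cont by (intro continuous_intros)
  then have "connected (r ` {c<..<d})" by (intro connected_continuous_image) auto
  moreover have "r s \<le> 1" "1 \<le> r t" using assms(4) t r(1)[of s] r(1)[of t] by auto
  ultimately have "1 \<in> r ` {c<..<d}"
    using assms(3,5) connectedD_interval[of "r ` {c<..<d}" "r s" "r t" 1] by blast
  then show False using off r(2) by auto
qed

section \<open>Unfolded billiard orbits\<close>

text \<open>A non-singular orbit \<open>z\<close> in coordinates. \<open>leg n\<close> is the full straight line
  that carries the flight between the strikes \<open>n\<close> and \<open>n + 1\<close>. With full
  lines, the law of reflection is the identity of maps \<open>leg (Suc n) = R \<circ> leg n\<close>.
  The start \<open>(a0, a0)\<close> is on the long diagonal, and \<open>T\<close> is the time in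
  which the first leg advances by \<open>(p, p - 3 D)\<close>. The bounds on \<open>p\<close> state
  that \<open>p - 3 D < 0 < p + (p - 3 D)\<close>.\<close>

locale square_billiard =
  fixes z :: "real \<Rightarrow> real \<times> real" and \<tau> :: "nat \<Rightarrow> real"
    and leg :: "nat \<Rightarrow> real \<Rightarrow> real \<times> real" and a0 T :: real and p D :: int
  assumes a0: "0 < a0" "a0 < 1" and T: "0 < T"
    and p_D: "3 * D < 2 * p" "p < 3 * D" "coprime p D"
    and \<tau>: "\<tau> 0 = 0" "strict_mono \<tau>" "filterlim \<tau> at_top sequentially"
    and leg_0: "\<And>t. leg 0 t = (a0 + t / T * real_of_int p, a0 + t / T * real_of_int (p - 3 * D))"
    and leg: "\<And>n t. \<tau> n \<le> t \<Longrightarrow> t \<le> \<tau> (Suc n) \<Longrightarrow> z t = leg n t"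
    and off: "\<And>n t. \<tau> n < t \<Longrightarrow> t < \<tau> (Suc n) \<Longrightarrow> z t \<notin> square_sides"
    and strike: "\<And>n. \<exists>R. side_reflection R (z (\<tau> (Suc n))) \<and> (\<forall>t. leg (Suc n) t = R (leg n t))"
begin

abbreviation line :: "real \<Rightarrow> real \<times> real" where
  "line \<equiv> leg 0"

definition hits :: "real set" where
  "hits = {t. line t \<in> walls}"

definition strikes :: nat where
  "strikes = card (hits \<inter> {0<..T})"

lemma p_pos: "0 < p" "0 < D" using p_D by auto

text \<open>Each strike composes the map with one more reflection, which accounts for the parity.\<close>

lemma leg_unfolds: "\<exists>h. weyl (even n) h \<and> (\<forall>t. leg n t = h (line t))"
proof (induction n)
  case 0
  have "weyl True (\<lambda>(a, b). (a + real_of_int 0, b + real_of_int 0))" by (rule weylI) simp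
  then have "weyl True (\<lambda>x. x)" by (simp add: case_prod_unfold)
  then show ?case by auto
next
  case (Suc n)
  then obtain h where h: "weyl (even n) h" "\<And>t. leg n t = h (line t)" by blast
  obtain R where R: "side_reflection R (z (\<tau> (Suc n)))" "\<And>t. leg (Suc n) t = R (leg n t)"
    using strike by blast
  have "weyl (False = even n) (\<lambda>x. R (h x))"
    using side_reflection_weyl[OF R(1)] h(1) by (rule weyl_compose)
  with R(2) h(2) show ?case by (intro exI[of _ "\<lambda>x. R (h x)"]) simp
qed

lemma leg_affine: "\<exists>c u d v. leg n = (\<lambda>t. (c + t * u, d + t * v))"
proof -
  obtain h where h: "weyl (even n) h" "\<And>t. leg n t = h (line t)" using leg_unfolds by blast
  define u where "u = real_of_int p / T"
  define v where "v = real_of_int (p - 3 * D) / T"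
  have line: "line t = (a0 + t * u, a0 + t * v)" for t by (simp add: leg_0 u_def v_def)
  obtain m n' m' n'' i j where h': "h = (\<lambda>(a, b). (real_of_int m * a + real_of_int n' * b + real_of_int i,
      real_of_int m' * a + real_of_int n'' * b + real_of_int j))"
    using h(1) unfolding weyl_def by blast
  have "leg n = (\<lambda>t. ((m * a0 + n' * a0 + i) + t * (m * u + n' * v), (m' * a0 + n'' * a0 + j) + t * (m' * u + n'' * v)))"
    by (simp add: fun_eq_iff h(2) line h' algebra_simps)
  then show ?thesis by blast
qed

lemma leg_continuous: "continuous_on X (leg n)"
proof -
  obtain c u d v where "leg n = (\<lambda>t. (c + t * u, d + t * v))" using leg_affine by blast
  then show ?thesis by (auto intro!: continuous_intros)
qed

lemma leg_inside:
  assumes "\<forall>\<^sub>F t in at_right (\<tau> n). leg n t \<in> open_square" "\<tau> n < t" "t < \<tau> (Suc n)"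
  shows "leg n t \<in> open_square"
proof -
  have "\<tau> n < \<tau> (Suc n)" using \<tau>(2) by (simp add: strict_mono_Suc_iff)
  then have "\<forall>\<^sub>F t in at_right (\<tau> n). leg n t \<in> open_square \<and> t \<in> {\<tau> n<..<\<tau> (Suc n)}"
    by (intro eventually_conj assms(1) eventually_at_right_real)
  then obtain s where s: "leg n s \<in> open_square" "s \<in> {\<tau> n<..<\<tau> (Suc n)}"
    using eventually_happens'[OF trivial_limit_at_right_real] by blast
  have "leg n r \<notin> square_sides" if "r \<in> {\<tau> n<..<\<tau> (Suc n)}" for r
    using that off[of n r] leg[of n r] by simp
  from stays_in_open_square[OF leg_continuous this s(2,1), of t] show ?thesis
    using assms by simp
qed

lemma \<tau>_less: "\<tau> n < \<tau> (Suc n)"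
  using \<tau>(2) by (simp add: strict_mono_Suc_iff)

lemma leg_enters: "\<forall>\<^sub>F t in at_right (\<tau> n). leg n t \<in> open_square"
proof (induction n)
  case 0
  have "(line \<longlongrightarrow> line 0) (at_right 0)"
    using leg_continuous[of UNIV 0] by (auto simp: continuous_on_def intro: tendsto_within_subset)
  moreover have "open open_square" unfolding open_square_def by (intro open_Times) auto
  moreover have "line 0 \<in> open_square" using a0 by (simp add: leg_0 open_square_def)
  ultimately show ?case unfolding \<tau>(1) by (rule topological_tendstoD)
next
  case (Suc n)
  obtain c u d v where x: "leg n = (\<lambda>t. (c + t * u, d + t * v))" using leg_affine by blast
  obtain R where R: "side_reflection R (z (\<tau> (Suc n)))" "\<And>t. leg (Suc n) t = R (leg n t)"
    using strike by blast
  obtain s where s: "\<tau> n < s" "s < \<tau> (Suc n)" using dense \<tau>_less by blast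
  have "z (\<tau> (Suc n)) = leg n (\<tau> (Suc n))" using \<tau>_less[of n] by (intro leg) auto
  with R(1) have "side_reflection R (leg n (\<tau> (Suc n)))" by simp
  from side_reflection_enters[OF s(2) x leg_inside[OF Suc s] this] show ?case
    by (simp add: R(2))
qed

lemma inside: "\<tau> n < t \<Longrightarrow> t < \<tau> (Suc n) \<Longrightarrow> z t \<in> open_square"
  using leg_inside[OF leg_enters, of n t] leg[of n t] by simp

lemma locate:
  assumes "0 \<le> t"
  obtains n where "\<tau> n \<le> t" "t < \<tau> (Suc n)"
proof -
  obtain m where m: "t < \<tau> m"
    using filterlim_at_top_dense[THEN iffD1, OF \<tau>(3), rule_format, of t] by (auto simp: eventually_sequentially)
  define k where "k = (LEAST m. t < \<tau> m)"
  have k: "t < \<tau> k" unfolding k_def using m by (rule LeastI)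
  then have "k \<noteq> 0" using assms \<tau>(1) by (metis not_le)
  then obtain n where n: "k = Suc n" by (cases k) auto
  then have "\<not> t < \<tau> n" unfolding k_def by (intro not_less_Least) simp
  then show ?thesis using that[of n] k n by (simp add: not_less)
qed

lemma unfold_at:
  obtains h where "weyl (even n) h" "\<And>t. \<tau> n \<le> t \<Longrightarrow> t \<le> \<tau> (Suc n) \<Longrightarrow> z t = h (line t)"
proof -
  obtain h where "weyl (even n) h" "\<forall>t. leg n t = h (line t)" using leg_unfolds by blast
  then show ?thesis using leg by (intro that[of h]) simp_all
qed

text \<open>Both \<open>walls\<close> and the lattice are invariant under the group, so that it does not matter
  which map of the group folds the line at time \<open>t\<close>. Inside the square there are no
  walls and no lattice points.\<close>

lemma strike_times:
  assumes "0 < t"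
  shows "(t \<in> hits \<longleftrightarrow> (\<exists>n. t = \<tau> (Suc n))) \<and> (z t \<in> square_sides \<longleftrightarrow> (\<exists>n. t = \<tau> (Suc n)))
    \<and> z t \<notin> \<int> \<times> \<int>"
proof -
  obtain n where n: "\<tau> n \<le> t" "t < \<tau> (Suc n)" using locate[of t] assms by auto
  obtain h where h: "weyl (even n) h" "z t = h (line t)" using unfold_at[of n] n by (metis less_imp_le)
  have hits: "t \<in> hits \<longleftrightarrow> z t \<in> walls" using weyl_walls_iff[OF h(1), of "line t"] by (simp add: hits_def h(2))
  show ?thesis
  proof (cases "\<tau> n = t")
    case True
    with assms \<tau>(1) obtain m where "n = Suc m" by (cases n) auto
    with True strike obtain R where "side_reflection R (z t)" by blast
    then have "z t \<in> walls" "z t \<in> square_sides" "z t \<notin> \<int> \<times> \<int>"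
      by (auto dest: side_reflection_walls side_reflection_sides)
    moreover have "\<exists>m. t = \<tau> (Suc m)" using True \<open>n = Suc m\<close> by blast
    ultimately show ?thesis using hits by simp
  next
    case False
    with n have "z t \<in> open_square" by (intro inside) auto
    then have "z t \<notin> walls" "z t \<notin> square_sides" "z t \<notin> \<int> \<times> \<int>"
      using walls_disjoint_open_square not_int_between[of 0] by (auto simp: open_square_def square_sides_def)
    moreover have "t \<noteq> \<tau> (Suc m)" for m
    proof
      assume "t = \<tau> (Suc m)"
      with n False have "\<tau> n < \<tau> (Suc m)" "\<tau> (Suc m) < \<tau> (Suc n)" by auto
      then show False unfolding strict_mono_less[OF \<tau>(2)] by simp
    qed
    ultimately show ?thesis using hits by auto
  qed
qed

lemma line_avoids_lattice:
  assumes "0 < t"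
  shows "line t \<notin> \<int> \<times> \<int>"
proof -
  obtain n where n: "\<tau> n \<le> t" "t < \<tau> (Suc n)" using locate[of t] assms by auto
  obtain h where h: "weyl (even n) h" "z t = h (line t)" using unfold_at[of n] n by (metis less_imp_le)
  show ?thesis using strike_times[OF assms] weyl_lattice[OF h(1), of "line t"] h(2) by auto
qed

lemma hits_upto:
  assumes "\<tau> n \<le> t" "t < \<tau> (Suc n)"
  shows "finite (hits \<inter> {0<..t})" "card (hits \<inter> {0<..t}) = n"
proof -
  have "hits \<inter> {0<..t} = \<tau> ` {1..n}"
  proof (intro equalityI subsetI)
    fix s assume s: "s \<in> hits \<inter> {0<..t}"
    then obtain m where m: "s = \<tau> (Suc m)" using strike_times[of s] by auto
    with s assms have "\<tau> (Suc m) < \<tau> (Suc n)" by auto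
    then have "Suc m \<in> {1..n}" using strict_mono_less[OF \<tau>(2)] by auto
    with m show "s \<in> \<tau> ` {1..n}" by blast
  next
    fix s assume "s \<in> \<tau> ` {1..n}"
    then obtain i where i: "s = \<tau> i" "1 \<le> i" "i \<le> n" by auto
    then obtain m where "i = Suc m" by (cases i) auto
    with i have m: "s = \<tau> (Suc m)" "Suc m \<le> n" by auto
    have "\<tau> 0 < s" "s \<le> \<tau> n"
      using m strict_mono_less[OF \<tau>(2)] strict_mono_less_eq[OF \<tau>(2)] by auto
    then show "s \<in> hits \<inter> {0<..t}" using strike_times[of s] m assms \<tau>(1) by auto
  qed
  moreover have "inj_on \<tau> {1..n}" by (simp add: inj_on_def strict_mono_eq[OF \<tau>(2)])
  ultimately show "finite (hits \<inter> {0<..t})" "card (hits \<inter> {0<..t}) = n" by (auto simp: card_image)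
qed

lemma hits_finite: "finite (hits \<inter> {c<..d})" if "0 \<le> c"
proof (cases "c \<le> d")
  case True
  with that obtain n where "\<tau> n \<le> d" "d < \<tau> (Suc n)" using locate[of d] by auto
  from hits_upto(1)[OF this] show ?thesis
    by (rule rev_finite_subset) (use that in auto)
qed auto

definition shift :: "nat \<Rightarrow> real \<times> real \<Rightarrow> real \<times> real" where
  "shift k = (\<lambda>(a, b). (a + real_of_int (int k * p), b + real_of_int (int k * (p - 3 * D))))"

lemma shift_weyl: "weyl True (shift k)"
  unfolding shift_def by (rule weylI(1)) (simp add: algebra_simps)

lemma line_shift: "line (t + of_nat k * T) = shift k (line t)"
  using T by (simp add: leg_0 shift_def add_divide_distrib algebra_simps)

lemma hits_periodic: "t + T \<in> hits \<longleftrightarrow> t \<in> hits"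
  using line_shift[of t 1] by (simp add: hits_def weyl_walls_iff[OF shift_weyl])

lemma hits_window:
  assumes "0 \<le> t"
  shows "card (hits \<inter> {t<..t + T}) = strikes"
  using card_periodic_window[of T hits t 0] T hits_periodic hits_finite assms by (simp add: strikes_def)

lemma hits_windows:
  assumes "0 \<le> t"
  shows "card (hits \<inter> {t<..t + of_nat k * T}) = k * strikes"
proof (induction k)
  case (Suc k)
  define s where "s = t + of_nat k * T"
  have s: "0 \<le> s" "t \<le> s" using assms T by (auto simp: s_def)
  have step: "t + of_nat (Suc k) * T = s + T" by (simp add: s_def algebra_simps)
  have "hits \<inter> {t<..t + of_nat (Suc k) * T} = (hits \<inter> {t<..s}) \<union> (hits \<inter> {s<..s + T})"
    unfolding step using s T by auto
  also have "card \<dots> = card (hits \<inter> {t<..s}) + card (hits \<inter> {s<..s + T})"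
    using assms s by (intro card_Un_disjoint hits_finite) auto
  finally show ?case using Suc hits_window[OF s(1)] by (simp add: s_def)
qed simp

text \<open>By periodicity of the set \<open>hits\<close>, the number of strikes during \<open>k T\<close> does
  not depend on the starting time. So the parity of the folding map changes by \<open>k S\<close>
  between \<open>t\<close> and \<open>t + k T\<close> for every \<open>t\<close>.\<close>

lemma strike_parity:
  assumes "0 \<le> t" "\<tau> n \<le> t" "t < \<tau> (Suc n)" "\<tau> m \<le> t + of_nat k * T" "t + of_nat k * T < \<tau> (Suc m)"
  shows "m = n + k * strikes"
proof -
  have "0 \<le> of_nat k * T" using T by simp
  then have "hits \<inter> {0<..t + of_nat k * T} = (hits \<inter> {0<..t}) \<union> (hits \<inter> {t<..t + of_nat k * T})"
    using assms(1) by auto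
  also have "card \<dots> = card (hits \<inter> {0<..t}) + card (hits \<inter> {t<..t + of_nat k * T})"
    using assms by (intro card_Un_disjoint hits_finite) auto
  finally show ?thesis using hits_upto(2) assms hits_windows by simp
qed

text \<open>The map that takes \<open>z s\<close> to \<open>z (s + k T)\<close> is composed of unfolding,
  translation and folding. It belongs to the group, and it preserves orientation by
  \<open>strike_parity\<close>. For \<open>s\<close> strictly between strikes it moves an interior
  point of the square into the square, so it is the identity. The same map serves at the time
  \<open>t\<close> itself, which may be a strike.\<close>

lemma retraces:
  assumes "even (k * strikes)" "0 \<le> t"
  shows "z (t + of_nat k * T) = z t"
proof -
  define U where "U = of_nat k * T"
  have "0 \<le> U" using T by (simp add: U_def)
  obtain n where n: "\<tau> n \<le> t" "t < \<tau> (Suc n)" using locate assms(2) by blast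
  obtain m where m: "\<tau> m \<le> t + U" "t + U < \<tau> (Suc m)" using locate[of "t + U"] assms(2) \<open>0 \<le> U\<close> by auto
  have "m = n + k * strikes" using strike_parity[OF assms(2) n] m unfolding U_def by blast
  then have par: "even m = even n" using assms(1) by simp
  obtain h where h: "weyl (even n) h" "\<And>t. \<tau> n \<le> t \<Longrightarrow> t \<le> \<tau> (Suc n) \<Longrightarrow> z t = h (line t)"
    using unfold_at[of n] by blast
  obtain g where g: "weyl (even m) g" "\<And>t. \<tau> m \<le> t \<Longrightarrow> t \<le> \<tau> (Suc m) \<Longrightarrow> z t = g (line t)"
    using unfold_at[of m] by blast
  obtain h' where h': "weyl (even n) h'" "\<And>x. h' (h x) = x" using weyl_inverse[OF h(1)] by blast
  have "weyl (even m = (True = even n)) (\<lambda>x. g (shift k (h' x)))"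
    using weyl_compose[OF g(1) weyl_compose[OF shift_weyl h'(1)]] by simp
  then have w: "weyl True (\<lambda>x. g (shift k (h' x)))" using par by simp
  have gh: "g (shift k (h' (h x))) = g (shift k x)" for x by (simp add: h')
  obtain s where s: "t < s" "s < min (\<tau> (Suc n)) (\<tau> (Suc m) - U)"
    using dense[of t "min (\<tau> (Suc n)) (\<tau> (Suc m) - U)"] n m by auto
  have zs: "z s = h (line s)" "z (s + U) = g (line (s + U))"
    using s n m by (auto intro!: h g)
  then have "z (s + U) = g (shift k (h' (z s)))"
    using gh line_shift by (simp add: U_def)
  moreover have "z (s + U) \<in> open_square" using s m by (intro inside[of m]) auto
  moreover have "z s \<in> open_square" using s n by (intro inside[of n]) auto
  ultimately have "(\<lambda>x. g (shift k (h' x))) = (\<lambda>x. x)"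
    using weyl_True_fixes_square[OF w, of "fst (z s)" "snd (z s)"]
    by (auto simp: open_square_def mem_Times_iff)
  then have "g (shift k (h' (h (line t)))) = h (line t)" by metis
  then show ?thesis
    using h(2)[of t] g(2)[of "t + U"] n m gh line_shift by (simp add: U_def)
qed

text \<open>Retracing on an initial interval forces the folding map at time \<open>U\<close> to fix the
  direction of the line, so it is a translation of the group and the number of strikes until
  \<open>U\<close> is even. With \<open>r = U / T\<close>, this makes \<open>r p\<close> and
  \<open>r D\<close> integers. A Bezout identity for the coprime numbers \<open>p\<close> and
  \<open>D\<close> shows that \<open>r\<close> is an integer.\<close>

lemma retrace_time:
  assumes "0 < U" "\<And>t. 0 \<le> t \<Longrightarrow> z (t + U) = z t"
  obtains k where "U = of_nat k * T" "0 < k" "even (k * strikes)"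
proof -
  define q where "q = p - 3 * D"
  obtain n where n: "\<tau> n \<le> U" "U < \<tau> (Suc n)" using locate[of U] assms(1) by auto
  obtain h where h: "weyl (even n) h" "\<And>t. \<tau> n \<le> t \<Longrightarrow> t \<le> \<tau> (Suc n) \<Longrightarrow> z t = h (line t)"
    using unfold_at[of n] by blast
  define s where "s = min (\<tau> (Suc 0)) (\<tau> (Suc n) - U)"
  have s: "0 < s" using n \<tau>_less[of 0] \<tau>(1) by (simp add: s_def)
  have eq: "h (line (t + U)) = line t" if "0 \<le> t" "t \<le> s" for t
  proof -
    have "z (t + U) = h (line (t + U))" using that n by (intro h) (auto simp: s_def)
    moreover have "z t = line t" using that \<tau>(1) by (intro leg) (auto simp: s_def)
    ultimately show ?thesis using assms(2)[OF that(1)] by simp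
  qed
  have l: "line (t + U) = (a0 + U / T * p + t / T * p, a0 + U / T * q + t / T * q)" for t
    by (simp add: leg_0 q_def add_divide_distrib algebra_simps)
  have e0: "h (a0 + U / T * p, a0 + U / T * q) = (a0, a0)"
    using eq[of 0] s unfolding l by (simp add: leg_0)
  have es: "h (a0 + U / T * p + s / T * p, a0 + U / T * q + s / T * q) = (a0 + s / T * p, a0 + s / T * q)"
    using eq[of s] s unfolding l by (simp add: leg_0 q_def)
  have q: "real_of_int q < 0" "0 < real_of_int p + real_of_int q" using p_D by (auto simp: q_def simp flip: of_int_add)
  have "s / T \<noteq> 0" using s T by simp
  from weyl_fixed_direction[OF h(1) this q e0 es]
  obtain i j where "even n" and ij: "3 dvd (i - j)" "h = (\<lambda>(a, b). (a + real_of_int i, b + real_of_int j))"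
    by blast
  define r where "r = U / T"
  have rp: "r * p = - real_of_int i" and rq: "r * q = - real_of_int j"
    using e0 by (auto simp: ij r_def)
  obtain c where c: "i - j = 3 * c" using ij(1) by blast
  have "r * (3 * D) = r * p - r * q" by (simp add: q_def algebra_simps)
  also have "\<dots> = - real_of_int (3 * c)" using rp rq c by (simp flip: of_int_diff)
  finally have rD: "r * D = - real_of_int c" by simp
  obtain u v where "u * p + v * D = 1" using p_D(3) by (metis bezout_int coprime_imp_gcd_eq_1)
  then have "r = r * real_of_int (u * p + v * D)" by simp
  also have "\<dots> = u * (r * p) + v * (r * D)" by (simp add: algebra_simps)
  also have "\<dots> = real_of_int (- (u * i + v * c))" by (simp add: rp rD)
  finally have r: "r = real_of_int (- (u * i + v * c))" .
  moreover have "0 < r" using assms(1) T by (simp add: r_def)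
  ultimately have "0 < - (u * i + v * c)" by linarith
  then obtain k where k: "0 < k" "- (u * i + v * c) = int k" by (metis zero_less_imp_eq_int)
  then have "r = of_nat k" using r by simp
  then have U: "U = of_nat k * T" using T by (simp add: r_def field_simps)
  have "n = 0 + k * strikes"
    using strike_parity[of 0 0 n k] n \<tau>_less[of 0] \<tau>(1) by (simp add: U)
  with \<open>even n\<close> show ?thesis using that[OF U k(1)] by simp
qed

text \<open>The time at which the line meets \<open>a = k\<close>.\<close>

definition crossing :: "int \<Rightarrow> real" where
  "crossing k = (of_int k - a0) * T / p"

lemma line_crossing:
  "line (crossing k + \<theta> * T / p) = (of_int k + \<theta>,
     a0 + (of_int k - a0) * (p - 3 * D) / p - (3 * D - p) / p * \<theta>)"
  using T p_pos by (simp add: leg_0 crossing_def field_simps)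

lemma hits_between_crossings:
  assumes "1 \<le> k"
  shows "card (hits \<inter> {crossing k<..crossing (k + 1)}) =
    1 + (if (k - \<lfloor>a0 + (of_int k - a0) * (p - 3 * D) / p\<rfloor>) mod 3 = 2 then 1 else 0)"
proof -
  define b where "b = a0 + (of_int k - a0) * (p - 3 * D) / p"
  define \<delta> where "\<delta> = (3 * D - p) / real_of_int p"
  define W where "W = {\<theta> \<in> {0<..1::real}. (of_int k + \<theta>, b - \<delta> * \<theta>) \<in> walls}"
  define f where "f \<theta> = crossing k + \<theta> * T / p" for \<theta>
  have line: "line (f \<theta>) = (of_int k + \<theta>, b - \<delta> * \<theta>)" for \<theta>
    unfolding f_def line_crossing b_def \<delta>_def by simp
  have pos: "0 < crossing k" using assms a0 T p_pos by (simp add: crossing_def)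
  have "0 < f 0" "0 < f 1" using pos T p_pos by (auto simp: f_def add_pos_pos)
  then have "b \<notin> \<int>" "b - \<delta> \<notin> \<int>" using line_avoids_lattice[of "f 0"] line_avoids_lattice[of "f 1"] line[of 0] line[of 1] by auto
  moreover have "0 < \<delta>" "\<delta> < 1" using p_D p_pos by (auto simp: \<delta>_def simp flip: of_int_diff)
  ultimately have card: "card W = 1 + (if (k - \<lfloor>b\<rfloor>) mod 3 = 2 then 1 else 0)"
    using card_walls_strip[of b \<delta> k] by (simp add: W_def)
  have f1: "f 1 = crossing (k + 1)" using p_pos by (simp add: f_def crossing_def field_simps)
  have mono: "f r < f s \<longleftrightarrow> r < s" for r s using T p_pos by (simp add: f_def divide_less_cancel)
  have "hits \<inter> {crossing k<..crossing (k + 1)} = f ` W"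
  proof (intro equalityI subsetI)
    fix t assume t: "t \<in> hits \<inter> {crossing k<..crossing (k + 1)}"
    define \<theta> where "\<theta> = (t - crossing k) * p / T"
    have ft: "t = f \<theta>" using T p_pos by (simp add: f_def \<theta>_def)
    have "f 0 < f \<theta>" "\<not> f 1 < f \<theta>" using t ft f1 by (auto simp: f_def)
    then have "\<theta> \<in> W" using t ft line by (auto simp: mono W_def hits_def)
    with ft show "t \<in> f ` W" by blast
  next
    fix t assume "t \<in> f ` W"
    then obtain \<theta> where \<theta>: "t = f \<theta>" "\<theta> \<in> W" by blast
    then have "f 0 < f \<theta>" "\<not> f 1 < f \<theta>" by (auto simp: mono W_def)
    then show "t \<in> hits \<inter> {crossing k<..crossing (k + 1)}"
      using \<theta> line f1 by (auto simp: W_def hits_def f_def)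
  qed
  moreover have "inj_on f W" using T p_pos by (auto simp: inj_on_def f_def)
  ultimately show ?thesis using card by (simp add: card_image b_def)
qed

lemma hits_across:
  "card (hits \<inter> {crossing 1<..crossing (1 + int n)}) = n +
     card {k \<in> {1..int n}. (k - \<lfloor>a0 + (of_int k - a0) * (p - 3 * D) / p\<rfloor>) mod 3 = 2}"
proof (induction n)
  case (Suc n)
  define m where "m = 1 + int n"
  define C where "C = (\<lambda>k. (k - \<lfloor>a0 + (of_int k - a0) * (p - 3 * D) / p\<rfloor>) mod 3 = 2)"
  have m: "1 \<le> m" "1 + int (Suc n) = m + 1" "int (Suc n) = m" "int n = m - 1" by (auto simp: m_def)
  have mono: "crossing k \<le> crossing l \<longleftrightarrow> k \<le> l" for k l
    using T p_pos by (simp add: crossing_def divide_le_cancel)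
  have pos: "0 \<le> crossing k" if "1 \<le> k" for k using that a0 T p_pos by (simp add: crossing_def)
  have card_C: "card {k \<in> {1..m}. C k} = card {k \<in> {1..m - 1}. C k} + (if C m then 1 else 0)"
  proof -
    define B where "B = {k \<in> {1..m - 1}. C k}"
    have "B \<subseteq> {1..m - 1}" by (auto simp: B_def)
    then have B: "finite B" "m \<notin> B" by (auto intro: finite_subset)
    have "{k \<in> {1..m}. C k} = (if C m then insert m B else B)"
      using m(1) by (auto simp: order_le_less B_def)
    then show ?thesis using B unfolding B_def[symmetric] by simp
  qed
  have "hits \<inter> {crossing 1<..crossing (m + 1)}
      = (hits \<inter> {crossing 1<..crossing m}) \<union> (hits \<inter> {crossing m<..crossing (m + 1)})"
    using mono[of 1 m] mono[of m "m + 1"] m by auto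
  also have "card \<dots> = card (hits \<inter> {crossing 1<..crossing m}) + card (hits \<inter> {crossing m<..crossing (m + 1)})"
    using pos m by (intro card_Un_disjoint hits_finite) auto
  also have "\<dots> = n + card {k \<in> {1..m - 1}. C k} + (1 + (if C m then 1 else 0))"
    using Suc hits_between_crossings[OF m(1)] unfolding m(4) C_def by (simp add: m_def)
  also have "\<dots> = Suc n + card {k \<in> {1..m}. C k}" using card_C by linarith
  finally show ?case unfolding m(3) C_def add.commute[of 1 m] .
qed simp

text \<open>A window of length \<open>T\<close> that starts at a crossing consists of \<open>p\<close> complete
  steps. It starts at \<open>crossing 1\<close> because \<open>crossing 0\<close> is negative, and
  the line is known to avoid the lattice at positive times only.\<close>

lemma strikes_eq: "int strikes = p + p div 3 \<or> int strikes = p + (p + 2) div 3"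
proof -
  define \<theta> where "\<theta> = a0 - a0 * (p - 3 * D) / p"
  have *: "a0 + (of_int k - a0) * (p - 3 * D) / p = \<theta> + k * (p - 3 * D) / p" for k :: int
    using p_pos by (simp add: \<theta>_def field_simps)
  define c where "c = card {k \<in> {1..p}. (k - \<lfloor>\<theta> + k * (p - 3 * D) / p\<rfloor>) mod 3 = 2}"
  have "crossing (1 + int (nat p)) = crossing 1 + T" using p_pos T by (simp add: crossing_def field_simps)
  moreover have "0 \<le> crossing 1" using a0 T p_pos by (simp add: crossing_def)
  ultimately have "strikes = card (hits \<inter> {crossing 1<..crossing (1 + int (nat p))})"
    using hits_window by simp
  also have "\<dots> = nat p + c" unfolding hits_across * c_def using p_pos by simp
  finally have "int strikes = p + int c" using p_pos by simp
  moreover have "0 \<le> p div 3" "0 \<le> (p + 2) div 3" using p_pos by (simp_all add: pos_imp_zdiv_nonneg_iff)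
  then have "int c = p div 3 \<or> int c = (p + 2) div 3"
    using card_stripe[OF p_pos(1) p_D(3), of \<theta>] unfolding c_def[symmetric] by (elim insertE) auto
  ultimately show ?thesis by metis
qed

end

section \<open>The rhombus in lattice coordinates\<close>

text \<open>The coordinates of a vector in the basis \<open>l cis (\<pi> / 6)\<close>, \<open>l cis (- \<pi> /
  6)\<close> of the sides at \<open>A\<close>.\<close>

definition skew :: "real \<Rightarrow> complex \<Rightarrow> real \<times> real" where
  "skew l w = ((sqrt 3 / 3 * Re w + Im w) / l, (sqrt 3 / 3 * Re w - Im w) / l)"

definition coords :: "complex \<Rightarrow> real \<Rightarrow> complex \<Rightarrow> real \<times> real" where
  "coords A l z = skew l (z - A)"

lemma coords_add: "coords A l (z + s *\<^sub>R w) = coords A l z + s *\<^sub>R skew l w"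
  by (cases "l = 0") (simp_all add: coords_def skew_def field_simps)

lemma coords_inject:
  assumes "0 < l"
  shows "coords A l z = coords A l z' \<longleftrightarrow> z = z'"
proof
  assume "coords A l z = coords A l z'"
  then have "sqrt 3 / 3 * Re (z - A) + Im (z - A) = sqrt 3 / 3 * Re (z' - A) + Im (z' - A)"
    "sqrt 3 / 3 * Re (z - A) - Im (z - A) = sqrt 3 / 3 * Re (z' - A) - Im (z' - A)"
    using assms by (auto simp: coords_def skew_def)
  then have "Im (z - A) = Im (z' - A)" "sqrt 3 / 3 * Re (z - A) = sqrt 3 / 3 * Re (z' - A)" by linarith+
  then show "z = z'" by (simp add: complex_eq_iff)
qed simp

lemma coords_closed_segment:
  assumes "0 < l"
  shows "z \<in> closed_segment v w \<longleftrightarrow> coords A l z \<in> closed_segment (coords A l v) (coords A l w)"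
proof -
  have "coords A l ((1 - u) *\<^sub>R v + u *\<^sub>R w) = (1 - u) *\<^sub>R coords A l v + u *\<^sub>R coords A l w" for u
  proof -
    have "(1 - u) *\<^sub>R v + u *\<^sub>R w = v + u *\<^sub>R (w - v)" by (simp add: algebra_simps)
    moreover have "skew l (w - v) = coords A l w - coords A l v"
      by (simp add: coords_def skew_def algebra_simps diff_divide_distrib add_divide_distrib)
    ultimately have "coords A l ((1 - u) *\<^sub>R v + u *\<^sub>R w) = coords A l v + u *\<^sub>R (coords A l w - coords A l v)"
      by (simp only: coords_add)
    then show ?thesis by (simp add: algebra_simps)
  qed
  then show ?thesis unfolding in_segment by (metis coords_inject[OF assms])
qed

lemma coords_open_segment:
  assumes "0 < l"
  shows "z \<in> open_segment v w \<longleftrightarrow> coords A l z \<in> open_segment (coords A l v) (coords A l w)"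
  using coords_closed_segment[OF assms] coords_inject[OF assms] by (auto simp: open_segment_def)

lemma unit_segments:
  fixes a b :: real
  shows "(a, b) \<in> closed_segment (0, 0) (0, 1) \<longleftrightarrow> a = 0 \<and> 0 \<le> b \<and> b \<le> 1"
    "(a, b) \<in> closed_segment (0, 1) (1, 1) \<longleftrightarrow> b = 1 \<and> 0 \<le> a \<and> a \<le> 1"
    "(a, b) \<in> closed_segment (1, 1) (1, 0) \<longleftrightarrow> a = 1 \<and> 0 \<le> b \<and> b \<le> 1"
    "(a, b) \<in> closed_segment (1, 0) (0, 0) \<longleftrightarrow> b = 0 \<and> 0 \<le> a \<and> a \<le> 1"
    "(a, b) \<in> closed_segment (0, 0) (1, 1) \<longleftrightarrow> a = b \<and> 0 \<le> a \<and> a \<le> 1"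
proof -
  show "(a, b) \<in> closed_segment (0, 0) (0, 1) \<longleftrightarrow> a = 0 \<and> 0 \<le> b \<and> b \<le> 1" by (auto simp: in_segment)
  show "(a, b) \<in> closed_segment (0, 1) (1, 1) \<longleftrightarrow> b = 1 \<and> 0 \<le> a \<and> a \<le> 1" by (auto simp: in_segment)
  show "(a, b) \<in> closed_segment (1, 1) (1, 0) \<longleftrightarrow> a = 1 \<and> 0 \<le> b \<and> b \<le> 1"
    by (auto simp: in_segment intro: exI[of _ "1 - b"])
  show "(a, b) \<in> closed_segment (1, 0) (0, 0) \<longleftrightarrow> b = 0 \<and> 0 \<le> a \<and> a \<le> 1"
    by (auto simp: in_segment intro: exI[of _ "1 - a"])
  show "(a, b) \<in> closed_segment (0, 0) (1, 1) \<longleftrightarrow> a = b \<and> 0 \<le> a \<and> a \<le> 1" by (auto simp: in_segment)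
qed

lemma cis_30: "cis (pi / 6) = Complex (sqrt 3 / 2) (1 / 2)" "cis (- (pi / 6)) = Complex (sqrt 3 / 2) (- 1 / 2)"
  by (simp_all add: complex_eq_iff cos_30 sin_30)

lemma coords_vertices:
  assumes "0 < l"
  shows "coords A l A = (0, 0)" "coords A l (A + of_real l * cis (- (pi / 6))) = (0, 1)"
    "coords A l (rhombus60_C A l) = (1, 1)" "coords A l (A + of_real l * cis (pi / 6)) = (1, 0)"
  using assms by (simp_all add: coords_def skew_def rhombus60_C_def cis_30 field_simps)

lemma rhombus_vertices:
  "length (rhombus60 A l) = 4"
  "vertex (rhombus60 A l) 0 = A" "vertex (rhombus60 A l) 1 = A + of_real l * cis (- (pi / 6))"
  "vertex (rhombus60 A l) 2 = rhombus60_C A l" "vertex (rhombus60 A l) 3 = A + of_real l * cis (pi / 6)"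
  "vertex (rhombus60 A l) 4 = A"
proof -
  show length: "length (rhombus60 A l) = 4" by (simp add: rhombus60_def)
  show "vertex (rhombus60 A l) 0 = A" "vertex (rhombus60 A l) 1 = A + of_real l * cis (- (pi / 6))"
    "vertex (rhombus60 A l) 2 = rhombus60_C A l" "vertex (rhombus60 A l) 3 = A + of_real l * cis (pi / 6)"
    "vertex (rhombus60 A l) 4 = A"
    unfolding vertex_def length by (simp_all add: rhombus60_def)
qed

lemma less_4_cases: "i < 4 \<longleftrightarrow> i = 0 \<or> i = 1 \<or> i = 2 \<or> i = (3 :: nat)"
  by auto

lemma Suc_numerals: "Suc 0 = 1" "Suc 1 = 2" "Suc 2 = 3" "Suc 3 = 4"
  by simp_all

lemma coords_boundary:
  assumes "0 < l"
  shows "z \<in> boundary (rhombus60 A l) \<longleftrightarrow> coords A l z \<in> square_sides"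
proof -
  obtain a b where ab: "coords A l z = (a, b)" by (cases "coords A l z")
  have four: "{..<4 :: nat} = {0, 1, 2, 3}" by auto
  have "z \<in> boundary (rhombus60 A l) \<longleftrightarrow>
      (\<exists>i\<in>{0, 1, 2, 3}. z \<in> closed_segment (vertex (rhombus60 A l) i) (vertex (rhombus60 A l) (Suc i)))"
    unfolding boundary_def rhombus_vertices(1) four by (simp only: UN_iff)
  also have "\<dots> \<longleftrightarrow> (a = 0 \<and> 0 \<le> b \<and> b \<le> 1) \<or> (b = 1 \<and> 0 \<le> a \<and> a \<le> 1) \<or>
      (a = 1 \<and> 0 \<le> b \<and> b \<le> 1) \<or> (b = 0 \<and> 0 \<le> a \<and> a \<le> 1)"
    unfolding bex_simps Suc_numerals rhombus_vertices coords_closed_segment[OF assms, of z _ _ A]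
      coords_vertices[OF assms] ab unit_segments by simp
  also have "\<dots> \<longleftrightarrow> (a, b) \<in> square_sides" (is "?L \<longleftrightarrow> ?R")
  proof (cases "a = 0 \<or> a = 1 \<or> b = 0 \<or> b = 1")
    case True
    then show ?thesis by (elim disjE) (auto simp: square_sides_def open_square_def)
  next
    case False
    then have "\<not> ?L" by blast
    moreover from False have "\<not> ?R"
      by (simp add: square_sides_def open_square_def order_less_le)
    ultimately show ?thesis by simp
  qed
  finally show ?thesis by (simp add: ab)
qed

lemma reflect_velocity_unit:
  assumes "c \<noteq> 0" "d \<bullet> d = 1"
  shows "reflect_velocity (of_real c * d) w = (2 * (w \<bullet> d)) *\<^sub>R d - w"
proof -
  have "reflect_velocity (c *\<^sub>R d) w = ((2 * (c * (w \<bullet> d)) / (c * c)) * c) *\<^sub>R d - w"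
    by (simp add: reflect_velocity_def assms(2))
  also have "2 * (c * (w \<bullet> d)) / (c * c) * c = 2 * (w \<bullet> d)" using assms(1) by simp
  finally show ?thesis by (simp add: scaleR_conv_of_real)
qed

lemma skew_reflect_velocity:
  assumes "c \<noteq> 0" "skew l w = (u, v)"
  shows "skew l (reflect_velocity (of_real c * cis (pi / 6)) w) = (u + v, - v)"
    and "skew l (reflect_velocity (of_real c * cis (- (pi / 6))) w) = (- u, u + v)"
proof -
  have u: "u = (sqrt 3 / 3 * Re w + Im w) / l" and v: "v = (sqrt 3 / 3 * Re w - Im w) / l"
    using assms(2) by (auto simp: skew_def)
  have s3: "sqrt 3 * (sqrt 3 * r) = 3 * r" for r by (simp flip: mult.assoc)
  have unit: "cis (pi / 6) \<bullet> cis (pi / 6) = 1" "cis (- (pi / 6)) \<bullet> cis (- (pi / 6)) = 1"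
    by (simp_all add: inner_complex_def flip: power2_eq_square)
  define q where "q = reflect_velocity (of_real c * cis (pi / 6)) w"
  have e: "Re q = Re w / 2 + sqrt 3 * Im w / 2" "Im q = sqrt 3 * Re w / 2 - Im w / 2"
    unfolding q_def reflect_velocity_unit[OF assms(1) unit(1)]
    by (simp_all add: inner_complex_def cis_30 algebra_simps s3)
  have "sqrt 3 / 3 * Re q + Im q = (sqrt 3 / 3 * Re w + Im w) + (sqrt 3 / 3 * Re w - Im w)"
    "sqrt 3 / 3 * Re q - Im q = - (sqrt 3 / 3 * Re w - Im w)"
    unfolding e by (simp_all add: algebra_simps s3)
  then show "skew l (reflect_velocity (of_real c * cis (pi / 6)) w) = (u + v, - v)"
    unfolding q_def[symmetric] skew_def u v by (simp only: add_divide_distrib[symmetric] minus_divide_left)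
  define q' where "q' = reflect_velocity (of_real c * cis (- (pi / 6))) w"
  have e': "Re q' = Re w / 2 - sqrt 3 * Im w / 2" "Im q' = - (sqrt 3 * Re w / 2) - Im w / 2"
    unfolding q'_def reflect_velocity_unit[OF assms(1) unit(2)]
    by (simp_all add: inner_complex_def cis_30 algebra_simps s3)
  have "sqrt 3 / 3 * Re q' + Im q' = - (sqrt 3 / 3 * Re w + Im w)"
    "sqrt 3 / 3 * Re q' - Im q' = (sqrt 3 / 3 * Re w + Im w) + (sqrt 3 / 3 * Re w - Im w)"
    unfolding e' by (simp_all add: algebra_simps s3)
  then show "skew l (reflect_velocity (of_real c * cis (- (pi / 6))) w) = (- u, u + v)"
    unfolding q'_def[symmetric] skew_def u v by (simp only: add_divide_distrib[symmetric] minus_divide_left)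
qed

text \<open>The elastic reflection at a side is, in coordinates, the skew reflection of the square in the
  corresponding side. Stating it for all multiples \<open>s\<close> of the velocity gives the
  equality of whole legs.\<close>

lemma rhombus_strike:
  assumes "0 < l" "i < length (rhombus60 A l)"
    and z: "z \<in> open_segment (vertex (rhombus60 A l) i) (vertex (rhombus60 A l) (Suc i))"
  shows "\<exists>R. side_reflection R (coords A l z) \<and>
    (\<forall>s w. coords A l (z + s *\<^sub>R reflect_velocity (vertex (rhombus60 A l) (Suc i) - vertex (rhombus60 A l) i) w)
        = R (coords A l (z + s *\<^sub>R w)))"
proof -
  obtain a b where ab: "coords A l z = (a, b)" by (cases "coords A l z")
  note open_seg = z[unfolded coords_open_segment[OF \<open>0 < l\<close>, of z _ _ A]]
  have l: "l \<noteq> 0" "- l \<noteq> 0" using \<open>0 < l\<close> by auto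
  note seg = coords_vertices[OF \<open>0 < l\<close>] open_segment_def ab unit_segments
  have side: "vertex (rhombus60 A l) 1 - vertex (rhombus60 A l) 0 = of_real l * cis (- (pi / 6))"
    "vertex (rhombus60 A l) 2 - vertex (rhombus60 A l) 1 = of_real l * cis (pi / 6)"
    "vertex (rhombus60 A l) 3 - vertex (rhombus60 A l) 2 = of_real (- l) * cis (- (pi / 6))"
    "vertex (rhombus60 A l) 4 - vertex (rhombus60 A l) 3 = of_real (- l) * cis (pi / 6)"
    unfolding rhombus_vertices by (simp_all add: rhombus60_C_def cis_30 complex_eq_iff field_simps)
  have ev: "coords A l (z + s *\<^sub>R w) = (a + s * fst (skew l w), b + s * snd (skew l w))" for s w
    by (simp add: coords_add ab prod_eq_iff)
  have refl: "fst (skew l (reflect_velocity (of_real c * cis (pi / 6)) w)) = fst (skew l w) + snd (skew l w)"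
    "snd (skew l (reflect_velocity (of_real c * cis (pi / 6)) w)) = - snd (skew l w)"
    "fst (skew l (reflect_velocity (of_real c * cis (- (pi / 6))) w)) = - fst (skew l w)"
    "snd (skew l (reflect_velocity (of_real c * cis (- (pi / 6))) w)) = fst (skew l w) + snd (skew l w)"
    if "c \<noteq> 0" for c w
    using skew_reflect_velocity[OF that, of l w "fst (skew l w)" "snd (skew l w)"] by auto
  from assms(2) consider "i = 0" | "i = 1" | "i = 2" | "i = 3"
    unfolding rhombus_vertices(1) less_4_cases by blast
  then show ?thesis
  proof cases
    case 1
    from open_seg have "a = 0" "0 < b" "b < 1"
      unfolding 1 Suc_numerals rhombus_vertices seg by (auto simp: seg order_less_le)
    then show ?thesis unfolding 1 Suc_numerals side ev refl[OF l(1)] ab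
      by (intro exI[of _ "\<lambda>(a, b). (- a, a + b)"]) (simp add: side_reflection_def algebra_simps)
  next
    case 2
    from open_seg have "b = 1" "0 < a" "a < 1"
      unfolding 2 Suc_numerals rhombus_vertices seg by (auto simp: seg order_less_le)
    then show ?thesis unfolding 2 Suc_numerals side ev refl[OF l(1)] ab
      by (intro exI[of _ "\<lambda>(a, b). (a + b - 1, 2 - b)"]) (simp add: side_reflection_def algebra_simps)
  next
    case 3
    from open_seg have "a = 1" "0 < b" "b < 1"
      unfolding 3 Suc_numerals rhombus_vertices seg by (auto simp: seg order_less_le)
    then show ?thesis unfolding 3 Suc_numerals side ev refl[OF l(2)] ab
      by (intro exI[of _ "\<lambda>(a, b). (2 - a, a + b - 1)"]) (simp add: side_reflection_def algebra_simps)
  next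
    case 4
    from open_seg have "b = 0" "0 < a" "a < 1"
      unfolding 4 Suc_numerals rhombus_vertices seg by (auto simp: seg order_less_le)
    then show ?thesis unfolding 4 Suc_numerals side ev refl[OF l(2)] ab
      by (intro exI[of _ "\<lambda>(a, b). (a + b, - b)"]) (simp add: side_reflection_def algebra_simps)
  qed
qed

section \<open>Periods of orbits in the rhombus\<close>

lemma skew_direction:
  fixes x y :: nat and l :: real
  assumes "0 < x" "0 < l"
  defines "r \<equiv> sqrt 3 * l * sqrt ((real x)\<^sup>2 + 3 * (real y)\<^sup>2)"
  shows "skew l (cis (arctan (real y / real x * sqrt 3))) = ((real x + 3 * real y) / r, (real x - 3 * real y) / r)"
proof -
  define n where "n = sqrt ((real x)\<^sup>2 + 3 * (real y)\<^sup>2)"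
  define v where "v = real y / real x * sqrt 3"
  have pos: "0 < (real x)\<^sup>2 + 3 * (real y)\<^sup>2" using assms(1) by (simp add: add_pos_nonneg)
  then have n: "0 < n" by (simp add: n_def)
  have "1 + v\<^sup>2 = ((real x)\<^sup>2 + 3 * (real y)\<^sup>2) / (real x)\<^sup>2"
    using assms(1) by (simp add: v_def power_mult_distrib power_divide field_simps)
  then have "sqrt (1 + v\<^sup>2) = n / real x" by (simp add: n_def real_sqrt_divide)
  then have "cos (arctan v) = real x / n" "sin (arctan v) = sqrt 3 * real y / n"
    using assms(1) n by (simp_all add: cos_arctan sin_arctan v_def)
  then have cis: "Re (cis (arctan v)) = real x / n" "Im (cis (arctan v)) = sqrt 3 * real y / n" by simp_all
  have comp: "(sqrt 3 / 3 * (a / n) + sqrt 3 * b / n) / l = (a + 3 * b) / r" for a b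
  proof -
    have "r = sqrt 3 * l * n" by (simp add: r_def n_def)
    then show ?thesis using n assms(2) by (simp add: field_simps)
  qed
  show ?thesis
    unfolding v_def[symmetric] skew_def cis using comp[of "real x" "real y"] comp[of "real x" "- real y"] by simp
qed

lemma retraces_coords:
  assumes "0 < l"
  shows "retraces_after \<gamma> U \<longleftrightarrow> 0 < U \<and> (\<forall>t\<ge>0. coords A l (\<gamma> (t + U)) = coords A l (\<gamma> t))"
  using coords_inject[OF assms] by (simp add: retraces_after_def)

text \<open>The orbit retraces itself after \<open>k T\<close> for the least \<open>k \<in> {1, 2}\<close> that
  makes \<open>k S\<close> even, and it has \<open>k S\<close> strikes in that time.\<close>

lemma rhombus_orbit_period:
  fixes x y s :: nat and p D :: int
  assumes "0 < x" "x < y" "0 < l" "P \<in> open_segment A (rhombus60_C A l)"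
    and orbit: "nonsingular_orbit (rhombus60 A l) P (cis (arctan (real y / real x * sqrt 3))) \<gamma>"
    and p: "int s * p = int x + 3 * int y" "int s * D = 2 * int y" "coprime p D" and "0 < s"
  shows "\<exists>S. orbit_period (rhombus60 A l) \<gamma> = (if even S then S else 2 * S) \<and>
    (int S = p + p div 3 \<or> int S = p + (p + 2) div 3)"
proof -
  obtain \<tau> w where \<gamma>0: "\<gamma> 0 = P" and \<tau>: "\<tau> 0 = (0 :: real)" "strict_mono \<tau>" "filterlim \<tau> at_top sequentially"
    and w0: "w 0 = cis (arctan (real y / real x * sqrt 3))"
    and flight: "\<And>n t. \<tau> n \<le> t \<Longrightarrow> t \<le> \<tau> (Suc n) \<Longrightarrow> \<gamma> t = \<gamma> (\<tau> n) + (t - \<tau> n) *\<^sub>R w n"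
    and off: "\<And>n t. \<tau> n < t \<Longrightarrow> t < \<tau> (Suc n) \<Longrightarrow> \<gamma> t \<notin> boundary (rhombus60 A l)"
    and hit: "\<And>n. \<exists>i<length (rhombus60 A l).
         \<gamma> (\<tau> (Suc n)) \<in> open_segment (vertex (rhombus60 A l) i) (vertex (rhombus60 A l) (Suc i)) \<and>
         w (Suc n) = reflect_velocity (vertex (rhombus60 A l) (Suc i) - vertex (rhombus60 A l) i) (w n)"
    using orbit unfolding nonsingular_orbit_def by (elim conjE exE) (auto simp del: length_greater_0_conv)
  define z where "z t = coords A l (\<gamma> t)" for t
  define leg where "leg n t = coords A l (\<gamma> (\<tau> n) + (t - \<tau> n) *\<^sub>R w n)" for n t
  define r where "r = sqrt 3 * l * sqrt ((real x)\<^sup>2 + 3 * (real y)\<^sup>2)"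
  define T where "T = r / real s"
  have "0 < r" using assms by (simp add: r_def add_pos_nonneg)
  then have T: "0 < T" "r = real s * T" using \<open>0 < s\<close> by (auto simp: T_def)
  have "coords A l P \<in> open_segment (0, 0) (1, 1)"
    using assms(4) unfolding coords_open_segment[OF \<open>0 < l\<close>, of P _ _ A] coords_vertices[OF \<open>0 < l\<close>] .
  then obtain a0 where a0: "coords A l P = (a0, a0)" "0 < a0" "a0 < 1"
    by (cases "coords A l P") (auto simp: open_segment_def unit_segments order_less_le)
  have rp: "real_of_int p / T = (real x + 3 * real y) / r"
    and rq: "real_of_int (p - 3 * D) / T = (real x - 3 * real y) / r"
  proof -
    have "real s * real_of_int p = real x + 3 * real y" "real s * real_of_int D = 2 * real y"
      using p(1,2) by (metis of_int_add of_int_mult of_int_numeral of_int_of_nat_eq)+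
    then have "real x + 3 * real y = real s * real_of_int p"
      "real x - 3 * real y = real s * real_of_int (p - 3 * D)" by (simp_all add: algebra_simps)
    then show "real_of_int p / T = (real x + 3 * real y) / r"
      "real_of_int (p - 3 * D) / T = (real x - 3 * real y) / r"
      using \<open>0 < s\<close> by (simp_all add: T(2))
  qed
  have billiard: "square_billiard z \<tau> leg a0 T p D"
  proof
    show "0 < a0" "a0 < 1" "0 < T" by fact+
    have "int s * (3 * D) < int s * (2 * p)" "int s * p < int s * (3 * D)"
      using p(1,2) assms(1,2) by (simp_all add: algebra_simps)
    then show "3 * D < 2 * p" "p < 3 * D" using \<open>0 < s\<close> by simp_all
    show "coprime p D" by fact
    show "\<tau> 0 = 0" "strict_mono \<tau>" "filterlim \<tau> at_top sequentially" by fact+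
    show "leg 0 t = (a0 + t / T * real_of_int p, a0 + t / T * real_of_int (p - 3 * D))" for t
    proof -
      have "leg 0 t = (a0, a0) + t *\<^sub>R (real_of_int p / T, real_of_int (p - 3 * D) / T)"
        unfolding leg_def \<tau>(1) \<gamma>0 coords_add a0(1) w0 skew_direction[OF assms(1,3)] r_def[symmetric] rp rq by simp
      then show ?thesis by simp
    qed
    show "z t = leg n t" if "\<tau> n \<le> t" "t \<le> \<tau> (Suc n)" for n t
      unfolding z_def leg_def using flight[OF that] by simp
    show "z t \<notin> square_sides" if "\<tau> n < t" "t < \<tau> (Suc n)" for n t
      unfolding z_def using off[OF that] coords_boundary[OF \<open>0 < l\<close>] by blast
    show "\<exists>R. side_reflection R (z (\<tau> (Suc n))) \<and> (\<forall>t. leg (Suc n) t = R (leg n t))" for n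
    proof -
      obtain i where i: "i < length (rhombus60 A l)"
        "\<gamma> (\<tau> (Suc n)) \<in> open_segment (vertex (rhombus60 A l) i) (vertex (rhombus60 A l) (Suc i))"
        "w (Suc n) = reflect_velocity (vertex (rhombus60 A l) (Suc i) - vertex (rhombus60 A l) i) (w n)"
        using hit by blast
      have "\<tau> n \<le> \<tau> (Suc n)" using \<tau>(2) by (simp add: strict_mono_less_eq)
      then have "\<gamma> (\<tau> (Suc n)) = \<gamma> (\<tau> n) + (\<tau> (Suc n) - \<tau> n) *\<^sub>R w n" by (intro flight) auto
      then have "\<gamma> (\<tau> n) + (t - \<tau> n) *\<^sub>R w n = \<gamma> (\<tau> (Suc n)) + (t - \<tau> (Suc n)) *\<^sub>R w n" for t
        by (simp add: algebra_simps)
      then have "leg n t = coords A l (\<gamma> (\<tau> (Suc n)) + (t - \<tau> (Suc n)) *\<^sub>R w n)" for t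
        unfolding leg_def by simp
      moreover obtain R where "side_reflection R (z (\<tau> (Suc n)))"
        "\<And>s v. coords A l (\<gamma> (\<tau> (Suc n)) + s *\<^sub>R reflect_velocity (vertex (rhombus60 A l) (Suc i) - vertex (rhombus60 A l) i) v)
          = R (coords A l (\<gamma> (\<tau> (Suc n)) + s *\<^sub>R v))"
        using rhombus_strike[OF \<open>0 < l\<close> i(1,2)] unfolding z_def by blast
      ultimately show ?thesis unfolding leg_def i(3) by auto
    qed
  qed
  define S where "S = square_billiard.strikes leg T"
  define k :: nat where "k = (if even S then 1 else 2)"
  have retr: "retraces_after \<gamma> U \<longleftrightarrow> 0 < U \<and> (\<forall>t\<ge>0. z (t + U) = z t)" for U
    unfolding z_def by (rule retraces_coords[OF \<open>0 < l\<close>])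
  have "primitive_time \<gamma> = of_nat k * T"
    unfolding primitive_time_def
  proof (rule Least_equality)
    have "even (k * S)" by (simp add: k_def)
    then have "z (t + of_nat k * T) = z t" if "0 \<le> t" for t
      unfolding S_def using that by (rule square_billiard.retraces[OF billiard])
    then show "retraces_after \<gamma> (of_nat k * T)"
      unfolding retr using T by (auto simp: k_def)
  next
    fix U assume "retraces_after \<gamma> U"
    then have "0 < U" "\<And>t. 0 \<le> t \<Longrightarrow> z (t + U) = z t" unfolding retr by auto
    from square_billiard.retrace_time[OF billiard this]
    obtain m where m: "U = of_nat m * T" "0 < m" "even (m * S)" unfolding S_def by blast
    have "k \<le> m"
    proof (cases "even S")
      case False
      with m(3) have "even m" by simp
      with m(2) show ?thesis by (auto simp: k_def elim!: evenE)
    qed (use m in \<open>simp add: k_def\<close>)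
    then show "of_nat k * T \<le> U" using T m(1) by (simp add: mult_right_mono)
  qed
  moreover have "{t \<in> {0<..of_nat k * T}. \<gamma> t \<in> boundary (rhombus60 A l)} =
      square_billiard.hits leg \<inter> {0<..0 + of_nat k * T}"
  proof -
    have "\<gamma> t \<in> boundary (rhombus60 A l) \<longleftrightarrow> t \<in> square_billiard.hits leg" if "0 < t" for t
      using square_billiard.strike_times[OF billiard that] coords_boundary[OF \<open>0 < l\<close>, of "\<gamma> t" A]
      by (simp add: z_def)
    then show ?thesis by auto
  qed
  ultimately have "orbit_period (rhombus60 A l) \<gamma> = k * S"
    unfolding orbit_period_def S_def using square_billiard.hits_windows[OF billiard, of 0 k] by simp
  then show ?thesis
    using square_billiard.strikes_eq[OF billiard] by (intro exI[of _ S]) (simp add: k_def S_def)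
qed

text \<open>The parity of \<open>S\<close> decides whether the period is \<open>S\<close> or \<open>2 S\<close>.
  If 3 divides \<open>p\<close> then \<open>S\<close> is \<open>4 p / 3\<close>. Otherwise the two
  roundings of \<open>p / 3\<close> give values of \<open>S\<close> of different parity, and the
  period takes two values.\<close>

lemma period_by_residue:
  fixes S :: nat and p e :: int
  assumes "int S = p + p div 3 \<or> int S = p + (p + 2) div 3"
  defines "N \<equiv> int (if even S then S else 2 * S)"
  shows "p = 3 * e \<Longrightarrow> N = 4 * e"
    and "p = 3 * e + 1 \<Longrightarrow> N = 4 * e + 2 \<or> N = 8 * e + 2"
    and "p = 3 * e + 2 \<Longrightarrow> N = 4 * e + 2 \<or> N = 8 * e + 6"
proof -
  have N: "N = (if even (int S) then int S else 2 * int S)" by (simp add: N_def)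
  have div3: "(3 * e + c) div 3 = e + c div 3" for c :: int by simp
  show "N = 4 * e" if "p = 3 * e"
  proof -
    have "int S = 4 * e" using assms(1) div3[of 0] div3[of 2] unfolding that by auto
    then show ?thesis by (simp add: N)
  qed
  show "N = 4 * e + 2 \<or> N = 8 * e + 2" if "p = 3 * e + 1"
  proof -
    have "int S = 4 * e + 1 \<or> int S = 4 * e + 2" using assms(1) div3[of 1] div3[of 3] unfolding that by auto
    then show ?thesis by (elim disjE; simp only: N; simp)
  qed
  show "N = 4 * e + 2 \<or> N = 8 * e + 6" if "p = 3 * e + 2"
  proof -
    have "int S = 4 * e + 2 \<or> int S = 4 * e + 3" using assms(1) div3[of 2] div3[of 4] unfolding that by auto
    then show ?thesis by (elim disjE; simp only: N; simp)
  qed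
qed

theorem mainTheorem2:
  fixes x y :: nat and A P :: complex and l \<Theta> :: real and \<gamma> :: "real \<Rightarrow> complex"
  assumes "0 < x" and "x < y" and "gcd x y = 1"
    and "0 < l"
    and "P \<in> open_segment A (rhombus60_C A l)"
    and "\<Theta> = arctan (real y / real x * sqrt 3)"
    and "periodic_orbit (rhombus60 A l) P (cis \<Theta>) \<gamma>"
  defines "p \<equiv> real (orbit_period (rhombus60 A l) \<gamma>)"
  shows "(x mod 3 = 0 \<and> x mod 2 = y mod 2 \<longrightarrow>
            p = 2 * real y + 2 * real x / 3) \<and>
         (x mod 3 = 0 \<and> x mod 2 \<noteq> y mod 2 \<longrightarrow>
            p = 4 * real y + 4 * real x / 3) \<and>
         (x mod 3 = 1 \<and> x mod 2 = y mod 2 \<longrightarrow>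
            p = 2 * real y + (2 * real x - 2) / 3 \<or> p = 4 * real y + (4 * real x + 2) / 3) \<and>
         (x mod 3 = 1 \<and> x mod 2 \<noteq> y mod 2 \<longrightarrow>
            p = 4 * real y + (4 * real x + 2) / 3 \<or> p = 8 * real y + (8 * real x - 2) / 3) \<and>
         (x mod 3 = 2 \<and> x mod 2 = y mod 2 \<longrightarrow>
            p = 2 * real y + (2 * real x + 2) / 3 \<or> p = 4 * real y + (4 * real x - 2) / 3) \<and>
         (x mod 3 = 2 \<and> x mod 2 \<noteq> y mod 2 \<longrightarrow>
            p = 4 * real y + (4 * real x - 2) / 3 \<or> p = 8 * real y + (8 * real x + 2) / 3)"
proof -
  define s :: nat where "s = (if x mod 2 = y mod 2 then 2 else 1)"
  define p where "p = (int x + 3 * int y) div int s"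
  define D where "D = 2 * int y div int s"
  have s: "0 < s" by (simp add: s_def)
  have "int s dvd int x + 3 * int y" "int s dvd 2 * int y" unfolding s_def by (auto; presburger)+
  then have sp: "int s * p = int x + 3 * int y" and sD: "int s * D = 2 * int y" by (simp_all add: p_def D_def)
  have xy: "coprime (int x) (int y)" using assms(3) by (simp add: coprime_iff_gcd_eq_1)
  have py: "coprime (int x + 3 * int y) (int y)"
  proof (rule coprimeI)
    fix c assume "c dvd int x + 3 * int y" and y: "c dvd int y"
    then have "c dvd int x" using dvd_add_left_iff[of c "3 * int y" "int x"] by simp
    then show "is_unit c" using xy y by (meson coprime_common_divisor)
  qed
  have "coprime p D"
  proof (cases "x mod 2 = y mod 2")
    case True
    then have "2 * p = int x + 3 * int y" "D = int y" using sp sD by (simp_all add: s_def)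
    then show ?thesis using py by (metis coprime_mult_left_iff)
  next
    case False
    then have pD: "p = int x + 3 * int y" "D = 2 * int y" using sp sD by (simp_all add: s_def)
    have "odd p" using False unfolding pD by presburger
    then show ?thesis using py pD by (simp add: coprime_mult_right_iff)
  qed
  then obtain S where S: "orbit_period (rhombus60 A l) \<gamma> = (if even S then S else 2 * S)"
    "int S = p + p div 3 \<or> int S = p + (p + 2) div 3"
    using rhombus_orbit_period[OF assms(1,2,4,5) _ sp sD _ s] assms(6,7) unfolding periodic_orbit_def by blast
  define N where "N = int (orbit_period (rhombus60 A l) \<gamma>)"
  define u where "u = int (x div 3)"
  note N = period_by_residue[OF S(2), folded S(1), folded N_def]
  have pN: "real (orbit_period (rhombus60 A l) \<gamma>) = of_int N" by (simp add: N_def)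
  have same: "2 * p = int x + 3 * int y" if "x mod 2 = y mod 2" using sp that by (simp add: s_def)
  have diff: "p = int x + 3 * int y" if "x mod 2 \<noteq> y mod 2" using sp that by (simp add: s_def)
  have x: "int x = 3 * u + int (x mod 3)"
    using div_mult_mod_eq[of x 3] unfolding u_def by (metis mult.commute of_nat_add of_nat_mult of_nat_numeral)
  have x0: "int x = 3 * u" if "x mod 3 = 0" using x that by simp
  have x1: "int x = 3 * u + 1" if "x mod 3 = 1" using x that by simp
  have x2: "int x = 3 * u + 2" if "x mod 3 = 2" using x that by simp
  note rx = arg_cong[OF x0, of real_of_int] arg_cong[OF x1, of real_of_int] arg_cong[OF x2, of real_of_int]
  have c1: "N = 2 * int y + 2 * u" if "x mod 3 = 0" "x mod 2 = y mod 2"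
  proof -
    have "p = 3 * (p - (u + int y))" using same[OF that(2)] x0[OF that(1)] by (simp add: algebra_simps)
    from N(1)[OF this] show ?thesis using same[OF that(2)] x0[OF that(1)] by auto
  qed
  have c2: "N = 4 * int y + 4 * u" if "x mod 3 = 0" "x mod 2 \<noteq> y mod 2"
  proof -
    have "p = 3 * (u + int y)" using diff[OF that(2)] x0[OF that(1)] by (simp add: algebra_simps)
    from N(1)[OF this] show ?thesis using diff[OF that(2)] x0[OF that(1)] by auto
  qed
  have c3: "N = 2 * int y + 2 * u \<or> N = 4 * int y + 4 * u + 2" if "x mod 3 = 1" "x mod 2 = y mod 2"
  proof -
    have "p = 3 * (p - (u + int y) - 1) + 2" using same[OF that(2)] x1[OF that(1)] by (simp add: algebra_simps)
    from N(3)[OF this] show ?thesis using same[OF that(2)] x1[OF that(1)] by auto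
  qed
  have c4: "N = 4 * int y + 4 * u + 2 \<or> N = 8 * int y + 8 * u + 2" if "x mod 3 = 1" "x mod 2 \<noteq> y mod 2"
  proof -
    have "p = 3 * (u + int y) + 1" using diff[OF that(2)] x1[OF that(1)] by (simp add: algebra_simps)
    from N(2)[OF this] show ?thesis using diff[OF that(2)] x1[OF that(1)] by auto
  qed
  have c5: "N = 2 * int y + 2 * u + 2 \<or> N = 4 * int y + 4 * u + 2" if "x mod 3 = 2" "x mod 2 = y mod 2"
  proof -
    have "p = 3 * (p - (u + int y) - 1) + 1" using same[OF that(2)] x2[OF that(1)] by (simp add: algebra_simps)
    from N(2)[OF this] show ?thesis using same[OF that(2)] x2[OF that(1)] by auto
  qed
  have c6: "N = 4 * int y + 4 * u + 2 \<or> N = 8 * int y + 8 * u + 6" if "x mod 3 = 2" "x mod 2 \<noteq> y mod 2"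
  proof -
    have "p = 3 * (u + int y) + 2" using diff[OF that(2)] x2[OF that(1)] by (simp add: algebra_simps)
    from N(3)[OF this] show ?thesis using diff[OF that(2)] x2[OF that(1)] by auto
  qed
  show ?thesis
    unfolding assms(8) pN
  proof (intro conjI impI; elim conjE)
    assume h: "x mod 3 = 0" "x mod 2 = y mod 2"
    show "of_int N = 2 * real y + 2 * real x / 3"
      using c1[OF h] rx(1)[OF h(1)] by auto
  next
    assume h: "x mod 3 = 0" "x mod 2 \<noteq> y mod 2"
    show "of_int N = 4 * real y + 4 * real x / 3"
      using c2[OF h] rx(1)[OF h(1)] by auto
  next
    assume h: "x mod 3 = 1" "x mod 2 = y mod 2"
    show "of_int N = 2 * real y + (2 * real x - 2) / 3 \<or> of_int N = 4 * real y + (4 * real x + 2) / 3"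
      using c3[OF h] rx(2)[OF h(1)] by auto
  next
    assume h: "x mod 3 = 1" "x mod 2 \<noteq> y mod 2"
    show "of_int N = 4 * real y + (4 * real x + 2) / 3 \<or> of_int N = 8 * real y + (8 * real x - 2) / 3"
      using c4[OF h] rx(2)[OF h(1)] by auto
  next
    assume h: "x mod 3 = 2" "x mod 2 = y mod 2"
    show "of_int N = 2 * real y + (2 * real x + 2) / 3 \<or> of_int N = 4 * real y + (4 * real x - 2) / 3"
      using c5[OF h] rx(3)[OF h(1)] by auto
  next
    assume h: "x mod 3 = 2" "x mod 2 \<noteq> y mod 2"
    show "of_int N = 4 * real y + (4 * real x - 2) / 3 \<or> of_int N = 8 * real y + (8 * real x + 2) / 3"
      using c6[OF h] rx(3)[OF h(1)] by auto
  qed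
qed

end
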